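(* Let $\mathbf{k}\in\mathbb{N}^d$ and suppose that the mixed multiplicity $e(M;\mathbf{k})$ of $M$ of the type $\mathbf{k}$ is defined. Then: (i) $e(M;\mathbf{k})$ is a non-negative integer. (ii) $\triangle^{\mathbf{k}}P_M(\mathbf{n})=e(M;\mathbf{k})$.
   Context: $\mathbb{N}$ denotes the nonnegative integers and $d\ge 1$ is an integer. $(A,\mathfrak{m})$ is an Artinian local ring with infinite residue field; $S=\bigoplus_{\mathbf{n}\in\mathbb{N}^d}S_{\mathbf{n}}$ is a finitely generated standard $\mathbb{N}^d$-graded (commutative) algebra over $A$, i.e. $S$ is generated over $A$ by elements of total degree $1$; $M=\bigoplus_{\mathbf{n}\in\mathbb{N}^d}M_{\mathbf{n}}$ is a finitely generated $\mathbb{N}^d$-graded $S$-module. On $\mathbb{N}^d$, $\le$ is componentwise, and $\mathbf{h}>\mathbf{k}$ means $\mathbf{h}\ge\mathbf{k}$ and $\mathbf{h}\ne\mathbf{k}$. "For all large $\mathbf{n}$" means for all $\mathbf{n}$ with every component sufficiently large. $\mathbf{e}_i$ is the $i$-th unit vector of $\mathbb{N}^d$. $\ell_A$ denotes length. For all large $\mathbf{n}$, $\ell_A[M_{\mathbf{n}}]$ equals a polynomial $P_M(\mathbf{n})$ (the Hilbert polynomial), written uniquely as $P_M(\mathbf{n})=\sum_{\mathbf{k}\in\mathbb{N}^d}e(M;\mathbf{k})\binom{\mathbf{n}+\mathbf{k}}{\mathbf{k}}$ with $e(M;\mathbf{k})\in\mathbb{Z}$, where $\binom{\mathbf{n}+\mathbf{k}}{\mathbf{k}}=\prod_{i=1}^d\binom{n_i+k_i}{k_i}$.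 The mixed multiplicity (of maximal degree) of $M$ of the type $\mathbf{k}$ is defined if $e(M;\mathbf{h})=0$ for all $\mathbf{h}>\mathbf{k}$, and is then the number $e(M;\mathbf{k})$. $\triangle^{\mathbf{k}}f$ denotes the $\mathbf{k}$-difference of a function $f(\mathbf{n})$: $\triangle^{\mathbf{e}_i}f(\mathbf{n})=f(\mathbf{n})-f(\mathbf{n}-\mathbf{e}_i)$ and $\triangle^{\mathbf{k}}=(\triangle^{\mathbf{e}_1})^{k_1}\cdots(\triangle^{\mathbf{e}_d})^{k_d}$. *)

theory Defs
  imports
    Complex_Main
    "HOL-Algebra.Module"
    "HOL-Algebra.QuotRing"
    "HOL-Algebra.Generated_Rings"
    "HOL-Library.Extended_Nat"
    "HOL-Library.Function_Algebras"
begin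

text \<open>
  Multi-indices are functions from a finite (hence nonempty) index type \<open>'d\<close> to \<open>nat\<close>, so that
  \<open>CARD('d)\<close> plays the role of d. The order \<open>\<le>\<close> on functions is the componentwise one, and
  \<open>k < h\<close> unfolds to \<open>k \<le> h\<close> and \<open>k \<noteq> h\<close>. Addition of multi-indices is pointwise.
\<close>

section \<open>Artinian local rings\<close>

locale artinian_local_ring = cring A
  for A :: "('a, 'x) ring_scheme" (structure) and \<mm> :: "'a set" +
  assumes maximal: "maximalideal \<mm> A"
    and maximal_unique: "maximalideal J A \<Longrightarrow> J = \<mm>"
    and descending_chain_condition:
      "\<lbrakk>\<And>n::nat. ideal (I n) A; \<And>n. I (Suc n) \<subseteq> I n\<rbrakk> \<Longrightarrow> \<exists>N. \<forall>n\<ge>N. I n = I N"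

section \<open>Multigraded algebras and modules\<close>

definition internal_direct_sum :: "('m, 'x) ring_scheme \<Rightarrow> ('i \<Rightarrow> 'm set) \<Rightarrow> bool" where
  "internal_direct_sum M G \<longleftrightarrow>
     (\<forall>n. subgroup (G n) (add_monoid M)) \<and>
     (\<forall>x\<in>carrier M. \<exists>!c. (\<forall>n. c n \<in> G n) \<and> finite {n. c n \<noteq> \<zero>\<^bsub>M\<^esub>} \<and>
        x = (\<Oplus>\<^bsub>M\<^esub>n\<in>{n. c n \<noteq> \<zero>\<^bsub>M\<^esub>}. c n))"

text \<open>The A-subalgebra generated by \<open>X\<close>; \<open>a \<odot> \<one>\<close> is the image of \<open>a\<close> under the structure map.\<close>

definition generated_subalgebra ::
  "('a, 'x) ring_scheme \<Rightarrow> ('a, 's, 'y) module_scheme \<Rightarrow> 's set \<Rightarrow> 's set" where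
  "generated_subalgebra A S X =
     generate_ring S ((\<lambda>a. a \<odot>\<^bsub>S\<^esub> \<one>\<^bsub>S\<^esub>) ` carrier A \<union> X)"

locale standard_multigraded_algebra = algebra A S
  for A :: "('a, 'x) ring_scheme" and S :: "('a, 's, 'y) module_scheme"
    and Sg :: "('d::finite \<Rightarrow> nat) \<Rightarrow> 's set" +
  assumes decomposition: "internal_direct_sum S Sg"
    and scalars_degree_zero: "a \<in> carrier A \<Longrightarrow> a \<odot>\<^bsub>S\<^esub> \<one>\<^bsub>S\<^esub> \<in> Sg 0"
    and mult_degree: "\<lbrakk>s \<in> Sg m; t \<in> Sg n\<rbrakk> \<Longrightarrow> s \<otimes>\<^bsub>S\<^esub> t \<in> Sg (m + n)"
    and finitely_generated:
      "\<exists>X. finite X \<and> X \<subseteq> carrier S \<and> generated_subalgebra A S X = carrier S"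
    and standard:
      "generated_subalgebra A S (\<Union>n\<in>{n. (\<Sum>i\<in>UNIV. n i) = 1}. Sg n) = carrier S"

locale fg_multigraded_module = module S M
  for S :: "('a, 's, 'y) module_scheme" and Sg :: "('d::finite \<Rightarrow> nat) \<Rightarrow> 's set"
    and M :: "('s, 'm, 'z) module_scheme" and Mg :: "('d \<Rightarrow> nat) \<Rightarrow> 'm set" +
  assumes decomposition: "internal_direct_sum M Mg"
    and smult_degree: "\<lbrakk>s \<in> Sg m; x \<in> Mg n\<rbrakk> \<Longrightarrow> s \<odot>\<^bsub>M\<^esub> x \<in> Mg (m + n)"
    and finitely_generated:
      "\<exists>X. finite X \<and> X \<subseteq> carrier M \<and> (\<lambda>H. submodule H S M) hull X = carrier M"

section \<open>Length\<close>

text \<open>The supremum of the lengths \<open>l\<close> of strictly increasing chains of submodules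
  \<open>C 0 \<subset> C 1 \<subset> \<dots> \<subset> C l\<close>.\<close>

definition module_length :: "('a, 'x) ring_scheme \<Rightarrow> ('a, 'm, 'z) module_scheme \<Rightarrow> enat" where
  "module_length A N =
     (SUP l \<in> {l. \<exists>C. (\<forall>i\<le>l. submodule (C i) A N) \<and> (\<forall>i<l. C i \<subset> C (Suc i))}. enat l)"

text \<open>A graded piece \<open>H\<close> of the S-module \<open>M\<close>, with scalars restricted along the structure map
  from A to S. The multiplicative fields of the record carry no meaning for modules.\<close>

definition graded_piece ::
  "('a, 's, 'y) module_scheme \<Rightarrow> ('s, 'm, 'z) module_scheme \<Rightarrow> 'm set \<Rightarrow> ('a, 'm) module" where
  "graded_piece S M H =
     \<lparr>carrier = H, monoid.mult = monoid.mult M, one = \<one>\<^bsub>M\<^esub>, zero = \<zero>\<^bsub>M\<^esub>, add = add M,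
      smult = (\<lambda>a x. (a \<odot>\<^bsub>S\<^esub> \<one>\<^bsub>S\<^esub>) \<odot>\<^bsub>M\<^esub> x)\<rparr>"

section \<open>Hilbert polynomial and mixed multiplicities\<close>

text \<open>Polynomials with rational coefficients are represented by the functions they induce on
  \<open>\<rat>\<^sup>d\<close>, so that an identity of polynomials is an equality of values at all rational points.\<close>

definition binomial_sum :: "(('d::finite \<Rightarrow> nat) \<Rightarrow> int) \<Rightarrow> ('d \<Rightarrow> rat) \<Rightarrow> rat" where
  "binomial_sum e n =
     (\<Sum>k\<in>{k. e k \<noteq> 0}. of_int (e k) * (\<Prod>i\<in>UNIV. (n i + of_nat (k i)) gchoose (k i)))"

definition is_hilbert_coeffs ::
  "('a, 'x) ring_scheme \<Rightarrow> ('a, 's, 'y) module_scheme \<Rightarrow> ('s, 'm, 'z) module_scheme \<Rightarrow>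
   (('d::finite \<Rightarrow> nat) \<Rightarrow> 'm set) \<Rightarrow> (('d \<Rightarrow> nat) \<Rightarrow> int) \<Rightarrow> bool" where
  "is_hilbert_coeffs A S M Mg e \<longleftrightarrow>
     finite {k. e k \<noteq> 0} \<and>
     (\<exists>N. \<forall>n. (\<forall>i. N \<le> n i) \<longrightarrow>
        (\<exists>l. module_length A (graded_piece S M (Mg n)) = enat l \<and>
             of_nat l = binomial_sum e (\<lambda>i. of_nat (n i))))"

definition hilbert_coeff ::
  "('a, 'x) ring_scheme \<Rightarrow> ('a, 's, 'y) module_scheme \<Rightarrow> ('s, 'm, 'z) module_scheme \<Rightarrow>
   (('d::finite \<Rightarrow> nat) \<Rightarrow> 'm set) \<Rightarrow> ('d \<Rightarrow> nat) \<Rightarrow> int" where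
  "hilbert_coeff A S M Mg = (THE e. is_hilbert_coeffs A S M Mg e)"

definition hilbert_polynomial ::
  "('a, 'x) ring_scheme \<Rightarrow> ('a, 's, 'y) module_scheme \<Rightarrow> ('s, 'm, 'z) module_scheme \<Rightarrow>
   (('d::finite \<Rightarrow> nat) \<Rightarrow> 'm set) \<Rightarrow> ('d \<Rightarrow> rat) \<Rightarrow> rat" where
  "hilbert_polynomial A S M Mg = binomial_sum (hilbert_coeff A S M Mg)"

text \<open>When this holds, the mixed multiplicity of type \<open>k\<close> is \<open>hilbert_coeff A S M Mg k\<close>.\<close>

definition mixed_multiplicity_defined ::
  "('a, 'x) ring_scheme \<Rightarrow> ('a, 's, 'y) module_scheme \<Rightarrow> ('s, 'm, 'z) module_scheme \<Rightarrow>
   (('d::finite \<Rightarrow> nat) \<Rightarrow> 'm set) \<Rightarrow> ('d \<Rightarrow> nat) \<Rightarrow> bool" where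
  "mixed_multiplicity_defined A S M Mg k \<longleftrightarrow> (\<forall>h>k. hilbert_coeff A S M Mg h = 0)"

section \<open>Differences\<close>

definition difference :: "'d \<Rightarrow> (('d \<Rightarrow> rat) \<Rightarrow> rat) \<Rightarrow> ('d \<Rightarrow> rat) \<Rightarrow> rat" where
  "difference i f n = f n - f (n(i := n i - 1))"

text \<open>The order of composition is immaterial, because the operators commute (shown below).\<close>

definition multi_difference ::
  "('d::finite \<Rightarrow> nat) \<Rightarrow> (('d \<Rightarrow> rat) \<Rightarrow> rat) \<Rightarrow> ('d \<Rightarrow> rat) \<Rightarrow> rat" where
  "multi_difference k f = Finite_Set.fold (\<lambda>i. difference i ^^ k i) f UNIV"

lemma difference_commute: "difference i (difference j f) = difference j (difference i f)"
  by (cases "i = j") (simp_all add: fun_eq_iff difference_def fun_upd_twist)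

lemma difference_power_commute:
  "(difference i ^^ a) ((difference j ^^ b) f) = (difference j ^^ b) ((difference i ^^ a) f)"
proof -
  have step: "(difference i ^^ a) (difference j f) = difference j ((difference i ^^ a) f)" for f
    by (induction a) (simp_all add: difference_commute[of i j])
  show ?thesis
    by (induction b) (simp_all add: step)
qed

interpretation multi_difference: comp_fun_commute "\<lambda>i. difference i ^^ k i" for k
  by (rule comp_fun_commute.intro) (simp add: fun_eq_iff difference_power_commute)

end

theory Submission
  imports Defs "HOL-Library.Product_Lexorder" "HOL-Computational_Algebra.Primes"
begin

text \<open>
  Both claims follow from one property of the Hilbert function
  \<open>n \<mapsto> \<ell>\<^sub>A(M\<^sub>n)\<close>: for large \<open>n\<close> it is a sum of products of binomials
  \<open>\<Prod>\<^sub>i binom (n\<^sub>i - u\<^sub>i + k\<^sub>i) k\<^sub>i\<close>, each of them occurring with a positive sign. Translating such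
  a product by \<open>u\<close> does not change its top coefficient, so every coefficient of the Hilbert
  polynomial that has only zero coefficients strictly above it is non-negative
  (\<open>nonneg_top\<close>, with closure under sums and translations in \<open>nonneg_top_add\<close> and
  \<open>nonneg_top_translate\<close>). The difference operator \<open>\<triangle>\<^sup>k\<close> shifts the coefficients by \<open>k\<close>
  (\<open>multi_difference_binomial_sum\<close>). This gives (ii), and it also shows that the coefficients of a
  polynomial are determined by its values at large \<open>n\<close>, hence that the Hilbert coefficients of the
  statement are the ones found here.
  
  The decomposition of the Hilbert function is the one that a Groebner basis gives over a field, in a
  version that works over an Artinian ring. Let \<open>X\<close> be a finite set of generators of \<open>S\<close> of degree 1
  and \<open>G\<close> a finite set of homogeneous generators of \<open>M\<close>. The products \<open>x\<^sup>a g\<close> of degree \<open>n\<close> span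
  \<open>M\<^sub>n\<close> over \<open>A\<close>. Order them by a monomial order and let \<open>l g a\<close> be the length of the cyclic
  \<open>A\<close>-module that \<open>x\<^sup>a g\<close> adds to the span of its predecessors. This length is finite because an
  Artinian ring has finite length (\<open>artinian_finite_length\<close>); the length of \<open>M\<^sub>n\<close> is the sum of the
  \<open>l g a\<close> (\<open>quotient_length_span_chain\<close>); and \<open>l g\<close> is antitone in the exponent \<open>a\<close>, because
  multiplication by a monomial respects the order and maps one cyclic module onto the other
  (\<open>quotient_length_cyclic_map\<close>).
  
  It remains to sum an antitone function \<open>l\<close> on \<open>\<nat>\<^sup>X\<close> over the exponents of a given degree. The
  slices of \<open>l\<close> in the direction of one variable decrease, and by Dickson's lemma they are constant
  from some index on (\<open>antitone_slices_stabilise\<close>). By induction on the number of variables, \<open>l\<close> is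
  therefore a finite sum of indicator functions of cones \<open>u + \<nat>\<^sup>F\<close> with \<open>F \<subseteq> X\<close>
  (\<open>antitone_sum_cone_counts\<close>). The number of points of degree \<open>n\<close> in a cone is the product of
  binomials above, or zero for large \<open>n\<close> if \<open>F\<close> misses some degree
  (\<open>positive_hilbert_type_cone_count\<close>).
\<close>

section \<open>Differences of binomial sums\<close>

definition binomial_basis :: "('d::finite \<Rightarrow> nat) \<Rightarrow> ('d \<Rightarrow> rat) \<Rightarrow> rat" where
  "binomial_basis k q = (\<Prod>i\<in>UNIV. (q i + of_nat (k i)) gchoose (k i))"

lemma binomial_sum_superset:
  assumes "finite K" "{k. e k \<noteq> 0} \<subseteq> K"
  shows "binomial_sum e q = (\<Sum>k\<in>K. of_int (e k) * binomial_basis k q)"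
  unfolding binomial_sum_def binomial_basis_def
  by (rule sum.mono_neutral_left) (use assms in auto)

lemma binomial_sum_add:
  assumes "finite {k. e k \<noteq> 0}" "finite {k. e' k \<noteq> 0}"
  shows "binomial_sum (\<lambda>k. e k + e' k) q = binomial_sum e q + binomial_sum e' q"
proof -
  let ?K = "{k. e k \<noteq> 0} \<union> {k. e' k \<noteq> 0}"
  have "finite ?K" using assms by simp
  then show ?thesis
    by (subst (1 2 3) binomial_sum_superset[of ?K])
       (auto simp: sum.distrib[symmetric] algebra_simps)
qed

lemma binomial_sum_diff:
  assumes "finite {k. e k \<noteq> 0}" "finite {k. e' k \<noteq> 0}"
  shows "binomial_sum (\<lambda>k. e k - e' k) q = binomial_sum e q - binomial_sum e' q"
proof -
  let ?K = "{k. e k \<noteq> 0} \<union> {k. e' k \<noteq> 0}"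
  have "finite ?K" using assms by simp
  then show ?thesis
    by (subst (1 2 3) binomial_sum_superset[of ?K])
       (auto simp: sum_subtractf[symmetric] algebra_simps)
qed

text \<open>
  Pascal's rule in the variable \<open>i\<close>: the upper argument \<open>q\<^sub>i + k\<^sub>i\<close> drops together with \<open>k\<^sub>i\<close>, so the
  basis is mapped to itself.
\<close>

lemma difference_binomial_basis:
  "difference i (binomial_basis k) q = (if k i = 0 then 0 else binomial_basis (k(i := k i - 1)) q)"
proof -
  let ?R = "\<Prod>j\<in>UNIV - {i}. (q j + of_nat (k j)) gchoose (k j)"
  have split: "binomial_basis l r = (r i + of_nat (l i) gchoose l i) *
      (\<Prod>j\<in>UNIV - {i}. (r j + of_nat (l j)) gchoose (l j))" for l r
    unfolding binomial_basis_def by (rule prod.remove) auto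
  have "difference i (binomial_basis k) q =
    ((q i + of_nat (k i) gchoose k i) - (q i - 1 + of_nat (k i) gchoose k i)) * ?R"
    unfolding difference_def split by (simp add: left_diff_distrib)
  also have "\<dots> = (if k i = 0 then 0 else binomial_basis (k(i := k i - 1)) q)"
  proof (cases "k i")
    case (Suc a)
    have "(q i + of_nat (k i) gchoose k i) - (q i - 1 + of_nat (k i) gchoose k i)
      = (q i + of_nat a gchoose a)"
      using gbinomial_Suc_Suc[of "q i + of_nat a" a] by (simp add: Suc algebra_simps)
    then show ?thesis by (simp add: split Suc)
  qed simp
  finally show ?thesis .
qed

lemma finite_shifted_support:
  assumes "finite {k. e k \<noteq> (0::int)}" "inj f"
  shows "finite {h. e (f h) \<noteq> 0}"
  using finite_vimageI[OF assms] by (simp add: vimage_def)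

lemma inj_raise: "inj (\<lambda>h::'d \<Rightarrow> nat. h(i := h i + a))"
proof (rule injI)
  fix g h :: "'d \<Rightarrow> nat" assume *: "g(i := g i + a) = h(i := h i + a)"
  show "g = h"
  proof
    fix j show "g j = h j" using fun_cong[OF *, of j] by (cases "j = i") auto
  qed
qed

text \<open>
  The difference operator only shifts the coefficient family. All later statements about differences
  and translations rest on this form.
\<close>

lemma difference_binomial_sum:
  assumes fin: "finite {k. e k \<noteq> 0}"
  shows "difference i (binomial_sum e) = binomial_sum (\<lambda>h. e (h(i := h i + 1)))"
proof
  fix q
  let ?K = "{k. e k \<noteq> 0}" and ?f = "\<lambda>h. h(i := h i + 1)" and ?g = "\<lambda>k. k(i := k i - 1)"
  have "difference i (binomial_sum e) q =
      (\<Sum>k\<in>?K. of_int (e k) * difference i (binomial_basis k) q)"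
    unfolding difference_def binomial_sum_superset[OF fin subset_refl]
    by (simp add: sum_subtractf[symmetric] right_diff_distrib)
  also have "\<dots> = (\<Sum>k\<in>{k\<in>?K. k i \<noteq> 0}. of_int (e k) * binomial_basis (?g k) q)"
    unfolding difference_binomial_basis using fin
    by (intro sum.mono_neutral_cong_right) auto
  also have "\<dots> = (\<Sum>h\<in>{h. e (?f h) \<noteq> 0}. of_int (e (?f h)) * binomial_basis h q)"
    by (rule sum.reindex_bij_witness[of _ ?f ?g]) auto
  also have "\<dots> = binomial_sum (\<lambda>h. e (?f h)) q"
    by (simp add: binomial_sum_def binomial_basis_def)
  finally show "difference i (binomial_sum e) q = binomial_sum (\<lambda>h. e (?f h)) q" .
qed

lemma difference_power_binomial_sum:
  assumes "finite {k. e k \<noteq> 0}"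
  shows "(difference i ^^ a) (binomial_sum e) = binomial_sum (\<lambda>h. e (h(i := h i + a)))"
proof (induction a)
  case (Suc a)
  have "(difference i ^^ Suc a) (binomial_sum e)
      = difference i (binomial_sum (\<lambda>h. e (h(i := h i + a))))"
    using Suc by (simp only: funpow.simps comp_apply)
  also have "\<dots> = binomial_sum (\<lambda>h. e (h(i := h i + Suc a)))"
  proof (subst difference_binomial_sum)
    show "finite {h. e (h(i := h i + a)) \<noteq> 0}"
      by (rule finite_shifted_support[OF assms inj_raise])
    have "h(i := h i + 1, i := (h(i := h i + 1)) i + a) = h(i := h i + Suc a)" for h :: "'a \<Rightarrow> nat"
      by (simp only: fun_upd_upd fun_upd_same add.assoc plus_1_eq_Suc)
    then show "binomial_sum (\<lambda>h. e (h(i := h i + 1, i := (h(i := h i + 1)) i + a)))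
        = binomial_sum (\<lambda>h. e (h(i := h i + Suc a)))" by presburger
  qed
  finally show ?case .
qed simp

lemma multi_difference_binomial_sum:
  fixes k :: "'d::finite \<Rightarrow> nat"
  assumes "finite {k. e k \<noteq> 0}"
  shows "multi_difference k (binomial_sum e) = binomial_sum (\<lambda>h. e (h + k))"
proof -
  have "Finite_Set.fold (\<lambda>i. difference i ^^ k i) (binomial_sum e) F
      = binomial_sum (\<lambda>h. e (h + (\<lambda>i. if i \<in> F then k i else 0)))" for F :: "'d set"
    using finite[of F]
  proof (induction F rule: finite_induct)
    case empty
    then show ?case by (simp add: plus_fun_def)
  next
    case (insert i F)
    let ?r = "\<lambda>F i. if i \<in> F then k i else 0"
    have inj: "inj (\<lambda>h. h + ?r F)" by (auto simp: inj_def)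
    have eq: "h(i := h i + k i) + ?r F = h + ?r (insert i F)" for h
      using insert.hyps by (auto simp: fun_eq_iff)
    have "Finite_Set.fold (\<lambda>i. difference i ^^ k i) (binomial_sum e) (insert i F)
        = (difference i ^^ k i) (binomial_sum (\<lambda>h. e (h + ?r F)))"
      by (simp only: multi_difference.fold_insert[OF insert.hyps] insert.IH)
    also have "\<dots> = binomial_sum (\<lambda>h. e (h(i := h i + k i) + ?r F))"
      by (rule difference_power_binomial_sum[OF finite_shifted_support[OF assms inj]])
    also have "\<dots> = binomial_sum (\<lambda>h. e (h + ?r (insert i F)))"
      by (simp only: eq)
    finally show ?case .
  qed
  from this[of UNIV] show ?thesis by (simp add: multi_difference_def)
qed

lemma less_add_multi_index: "h \<noteq> 0 \<Longrightarrow> k < h + k" for h k :: "'d \<Rightarrow> nat"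
  by (auto simp: less_fun_def le_fun_def fun_eq_iff)

text \<open>
  After the shift by \<open>k\<close> every coefficient other than the constant one comes from an index strictly
  above \<open>k\<close>.
\<close>

lemma multi_difference_top:
  assumes fin: "finite {k. e k \<noteq> 0}" and top: "\<And>h. k < h \<Longrightarrow> e h = 0"
  shows "multi_difference k (binomial_sum e) q = of_int (e k)"
proof -
  have "{h. e (h + k) \<noteq> 0} \<subseteq> {0}"
    using top less_add_multi_index by blast
  then have "binomial_sum (\<lambda>h. e (h + k)) q = of_int (e k)"
    by (subst binomial_sum_superset[of "{0}"]) (auto simp: binomial_basis_def)
  then show ?thesis by (simp add: multi_difference_binomial_sum[OF fin])
qed

text \<open>
  The values at integer points with all coordinates large are the only ones that the Hilbert function
  prescribes, so uniqueness of the coefficients has to be derived from them.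
\<close>

definition eventually_zero :: "(('d \<Rightarrow> rat) \<Rightarrow> rat) \<Rightarrow> bool" where
  "eventually_zero f \<longleftrightarrow> (\<exists>N. \<forall>n. (\<forall>i. N \<le> n i) \<longrightarrow> f (\<lambda>i. of_nat (n i)) = 0)"

lemma eventually_zero_difference:
  assumes "eventually_zero f"
  shows "eventually_zero (difference i f)"
proof -
  obtain N where N: "\<And>n. (\<And>i. N \<le> n i) \<Longrightarrow> f (\<lambda>i. of_nat (n i)) = 0"
    using assms by (auto simp: eventually_zero_def)
  have "difference i f (\<lambda>j. of_nat (n j)) = 0" if n: "\<And>j. Suc N \<le> n j" for n
  proof -
    have eq: "(\<lambda>j. of_nat (n j) :: rat)(i := of_nat (n i) - 1) = (\<lambda>j. of_nat ((n(i := n i - 1)) j))"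
      using n[of i] by (auto simp: fun_eq_iff of_nat_diff)
    have "f (\<lambda>j. of_nat ((n(i := n i - 1)) j)) = 0"
    proof (rule N)
      fix j show "N \<le> (n(i := n i - 1)) j" using n[of j] by (cases "j = i") auto
    qed
    moreover have "f (\<lambda>j. of_nat (n j)) = 0"
      using n by (intro N) (auto simp: Suc_leD)
    ultimately show ?thesis by (simp add: difference_def eq)
  qed
  then show ?thesis unfolding eventually_zero_def by blast
qed

lemma eventually_zero_multi_difference:
  assumes "eventually_zero f"
  shows "eventually_zero (multi_difference k f)"
proof -
  have power: "eventually_zero ((difference i ^^ a) g)" if "eventually_zero g" for i a g
    by (induction a) (simp_all add: that eventually_zero_difference)
  have "eventually_zero (Finite_Set.fold (\<lambda>i. difference i ^^ k i) f F)" for F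
    using finite[of F] by (induction F rule: finite_induct) (simp_all add: assms power)
  then show ?thesis by (simp add: multi_difference_def)
qed

text \<open>
  At a maximal index \<open>m\<close> of the support, \<open>\<triangle>\<^sup>m\<close> turns the sum into the constant \<open>e m\<close>, which is then
  eventually zero.
\<close>

lemma binomial_sum_eventually_zero:
  assumes fin: "finite {k. e k \<noteq> 0}" and zero: "eventually_zero (binomial_sum e)"
  shows "e k = 0"
proof (rule ccontr)
  assume "e k \<noteq> 0"
  then obtain m where m: "e m \<noteq> 0" "\<And>h. e h \<noteq> 0 \<Longrightarrow> m \<le> h \<Longrightarrow> m = h"
    using finite_has_maximal[OF fin] by auto
  then have "multi_difference m (binomial_sum e) q = of_int (e m)" for q
    by (intro multi_difference_top fin) (metis order_less_le)
  then have "multi_difference m (binomial_sum e) = (\<lambda>_. of_int (e m))" by (rule ext)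
  then have "eventually_zero (\<lambda>_::'a \<Rightarrow> rat. of_int (e m) :: rat)"
    using eventually_zero_multi_difference[OF zero, of m] by simp
  then obtain N where "\<And>n::'a \<Rightarrow> nat. (\<And>i. N \<le> n i) \<Longrightarrow> (of_int (e m) :: rat) = 0"
    unfolding eventually_zero_def by blast
  from this[of "\<lambda>_. N"] have "e m = 0" by simp
  with m show False by simp
qed

section \<open>Polynomials with non-negative top coefficients\<close>

definition nonneg_top :: "(('d::finite \<Rightarrow> nat) \<Rightarrow> int) \<Rightarrow> bool" where
  "nonneg_top e \<longleftrightarrow> finite {k. e k \<noteq> 0} \<and> (\<forall>k. (\<forall>h>k. e h = 0) \<longrightarrow> 0 \<le> e k)"

text \<open>
  Top coefficients cannot cancel: at a maximal index above \<open>k\<close> in the union of the two supports both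
  summands are top coefficients, hence non-negative, so they vanish if their sum does.
\<close>

lemma nonneg_top_add:
  assumes e: "nonneg_top e" and e': "nonneg_top e'"
  shows "nonneg_top (\<lambda>k. e k + e' k)"
  unfolding nonneg_top_def
proof (intro conjI allI impI)
  have fin: "finite ({k. e k \<noteq> 0} \<union> {k. e' k \<noteq> 0})"
    using e e' by (simp add: nonneg_top_def)
  then show "finite {k. e k + e' k \<noteq> 0}"
    by (rule finite_subset[rotated]) auto
  fix k assume top: "\<forall>h>k. e h + e' h = 0"
  let ?H = "{h. k < h \<and> (e h \<noteq> 0 \<or> e' h \<noteq> 0)}"
  have "?H = {}"
  proof (rule ccontr)
    assume "?H \<noteq> {}"
    moreover have "finite ?H" by (rule finite_subset[OF _ fin]) auto
    ultimately obtain m where m: "m \<in> ?H" "\<And>h. h \<in> ?H \<Longrightarrow> m \<le> h \<Longrightarrow> m = h"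
      using finite_has_maximal[of ?H] by blast
    have "\<forall>h>m. e h = 0 \<and> e' h = 0"
    proof (intro allI impI)
      fix h assume "m < h"
      with m have "k < h" "m \<le> h" "m \<noteq> h" by (auto dest: order_less_trans)
      with m(2)[of h] show "e h = 0 \<and> e' h = 0" by blast
    qed
    then have "0 \<le> e m" "0 \<le> e' m" using e e' by (simp_all add: nonneg_top_def)
    moreover have "e m + e' m = 0" using m(1) top by simp
    ultimately show False using m(1) by auto
  qed
  then have "\<forall>h>k. e h = 0" "\<forall>h>k. e' h = 0" by blast+
  then show "0 \<le> e k + e' k" using e e' by (simp add: nonneg_top_def)
qed

text \<open>
  These are the coefficients of the polynomial translated by one step in direction \<open>i\<close>, that is, of
  \<open>f - \<triangle>\<^sup>i f\<close>. If they vanish above \<open>k\<close>, then \<open>e\<close> is constant on every ray in direction \<open>i\<close> that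
  starts above \<open>k\<close>, and its finite support forces that constant to be zero.
\<close>

lemma nonneg_top_shift:
  assumes e: "nonneg_top e"
  shows "nonneg_top (\<lambda>k. e k - e (k(i := k i + 1)))"
  unfolding nonneg_top_def
proof (intro conjI allI impI)
  have fin: "finite {k. e k \<noteq> 0}" using e by (simp add: nonneg_top_def)
  have "finite ({k. e k \<noteq> 0} \<union> {k. e (k(i := k i + 1)) \<noteq> 0})"
    using fin finite_shifted_support[OF fin inj_raise] by blast
  then show "finite {k. e k - e (k(i := k i + 1)) \<noteq> 0}"
    by (rule finite_subset[rotated]) auto
  fix k assume top: "\<forall>h>k. e h - e (h(i := h i + 1)) = 0"
  have zero: "e h = 0" if h: "k < h" for h
  proof (rule ccontr)
    assume "e h \<noteq> 0"
    have "e (h(i := h i + a)) = e h" for a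
    proof (induction a)
      case (Suc a)
      define g where "g = h(i := h i + a)"
      have "h \<le> g" by (simp add: g_def le_fun_def)
      with h have "k < g" by (rule order_less_le_trans)
      with top have "e g = e (g(i := g i + 1))" by simp
      also have "g(i := g i + 1) = h(i := h i + Suc a)" by (simp add: g_def)
      finally show ?case using Suc by (simp only: g_def)
    qed simp
    with \<open>e h \<noteq> 0\<close> have "range (\<lambda>a. h(i := h i + a)) \<subseteq> {k. e k \<noteq> 0}" by auto
    moreover have "inj (\<lambda>a. h(i := h i + a))"
      by (rule injI) (metis add_left_cancel fun_upd_same)
    ultimately show False using fin finite_subset range_inj_infinite by blast
  qed
  moreover have "k < k(i := k i + 1)" by (auto simp: less_fun_def le_fun_def)
  ultimately show "0 \<le> e k - e (k(i := k i + 1))"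
    using e by (auto simp: nonneg_top_def)
qed

lemma nonneg_top_translate:
  fixes u :: "'d::finite \<Rightarrow> nat"
  assumes e: "nonneg_top e"
  obtains e' where "nonneg_top e'"
    "\<And>q. binomial_sum e' q = binomial_sum e (\<lambda>i. q i - of_nat (u i))"
proof -
  have one: "\<exists>e'. nonneg_top e' \<and> (\<forall>q. binomial_sum e' q = binomial_sum e (q(i := q i - 1)))"
    if "nonneg_top e" for e :: "('d \<Rightarrow> nat) \<Rightarrow> int" and i
  proof (intro exI conjI allI)
    show "nonneg_top (\<lambda>k. e k - e (k(i := k i + 1)))" by (rule nonneg_top_shift[OF that])
    fix q
    have fin: "finite {k. e k \<noteq> 0}" using that by (simp add: nonneg_top_def)
    show "binomial_sum (\<lambda>k. e k - e (k(i := k i + 1))) q = binomial_sum e (q(i := q i - 1))"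
      using fun_cong[OF difference_binomial_sum[OF fin, of i], of q]
      by (subst binomial_sum_diff[OF fin finite_shifted_support[OF fin inj_raise]])
         (simp add: difference_def)
  qed
  have many: "\<exists>e'. nonneg_top e' \<and>
      (\<forall>q. binomial_sum e' q = binomial_sum e (q(i := q i - of_nat a)))"
    if "nonneg_top e" for e :: "('d \<Rightarrow> nat) \<Rightarrow> int" and i a
  proof (induction a)
    case 0
    then show ?case using that by (auto intro!: exI[of _ e])
  next
    case (Suc a)
    then obtain e1 where e1: "nonneg_top e1"
      "\<And>q. binomial_sum e1 q = binomial_sum e (q(i := q i - of_nat a))" by blast
    obtain e2 where "nonneg_top e2" "\<And>q. binomial_sum e2 q = binomial_sum e1 (q(i := q i - 1))"
      using one[OF e1(1)] by blast
    moreover have "(q(i := q i - 1))(i := (q(i := q i - 1)) i - of_nat a)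
        = q(i := q i - of_nat (Suc a))" for q :: "'d \<Rightarrow> rat"
      by (rule ext) (simp add: algebra_simps)
    ultimately show ?case unfolding e1(2) by metis
  qed
  have "\<exists>e'. nonneg_top e' \<and>
      (\<forall>q. binomial_sum e' q = binomial_sum e (\<lambda>i. if i \<in> F then q i - of_nat (u i) else q i))"
    for F :: "'d set"
    using finite[of F]
  proof (induction F rule: finite_induct)
    case empty
    then show ?case using e by (auto intro!: exI[of _ e])
  next
    case (insert i F)
    then obtain e1 where e1: "nonneg_top e1"
      "\<And>q. binomial_sum e1 q = binomial_sum e (\<lambda>i. if i \<in> F then q i - of_nat (u i) else q i)"
      by blast
    obtain e2 where e2: "nonneg_top e2"
      "\<And>q. binomial_sum e2 q = binomial_sum e1 (q(i := q i - of_nat (u i)))"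
      using many[OF e1(1)] by blast
    have "(\<lambda>j. if j \<in> F then (q(i := q i - of_nat (u i))) j - of_nat (u j)
        else (q(i := q i - of_nat (u i))) j) =
      (\<lambda>j. if j \<in> insert i F then q j - of_nat (u j) else q j)" for q :: "'d \<Rightarrow> rat"
      using insert.hyps by (auto simp: fun_eq_iff)
    with e2 show ?case by (intro exI[of _ e2]) (simp add: e1(2) cong: if_cong)
  qed
  from this[of UNIV] that show ?thesis by auto
qed

lemma nonneg_top_single: "nonneg_top (\<lambda>h. if h = k then 1 else 0)"
  by (simp add: nonneg_top_def)

lemma binomial_sum_single: "binomial_sum (\<lambda>h. if h = k then 1 else 0) q = binomial_basis k q"
  by (subst binomial_sum_superset[of "{k}"]) auto

text \<open>
  The property of Hilbert functions from which both claims follow.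
\<close>

definition positive_hilbert_type :: "(('d::finite \<Rightarrow> nat) \<Rightarrow> nat) \<Rightarrow> bool" where
  "positive_hilbert_type f \<longleftrightarrow> (\<exists>e. nonneg_top e \<and>
     (\<exists>N. \<forall>n. (\<forall>i. N \<le> n i) \<longrightarrow> of_nat (f n) = binomial_sum e (\<lambda>i. of_nat (n i))))"

lemma positive_hilbert_type_zero: "positive_hilbert_type (\<lambda>_. 0)"
  unfolding positive_hilbert_type_def
  by (rule exI[of _ "\<lambda>_. 0"]) (simp add: nonneg_top_def binomial_sum_def)

lemma positive_hilbert_type_add:
  assumes "positive_hilbert_type f" "positive_hilbert_type g"
  shows "positive_hilbert_type (\<lambda>n. f n + g n)"
proof -
  obtain e1 N1 where 1: "nonneg_top e1"
      "\<And>n. (\<And>i. N1 \<le> n i) \<Longrightarrow> of_nat (f n) = binomial_sum e1 (\<lambda>i. of_nat (n i))"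
    using assms(1) unfolding positive_hilbert_type_def by blast
  obtain e2 N2 where 2: "nonneg_top e2"
      "\<And>n. (\<And>i. N2 \<le> n i) \<Longrightarrow> of_nat (g n) = binomial_sum e2 (\<lambda>i. of_nat (n i))"
    using assms(2) unfolding positive_hilbert_type_def by blast
  show ?thesis
    unfolding positive_hilbert_type_def
  proof (intro exI conjI allI impI)
    show "nonneg_top (\<lambda>k. e1 k + e2 k)" by (rule nonneg_top_add[OF 1(1) 2(1)])
    fix n :: "'a \<Rightarrow> nat" assume "\<forall>i. max N1 N2 \<le> n i"
    then show "of_nat (f n + g n) = binomial_sum (\<lambda>k. e1 k + e2 k) (\<lambda>i. of_nat (n i))"
      using 1 2 by (subst binomial_sum_add) (simp_all add: nonneg_top_def)
  qed
qed

lemma positive_hilbert_type_sum_list: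
  assumes "\<And>x. x \<in> set xs \<Longrightarrow> positive_hilbert_type (f x)"
  shows "positive_hilbert_type (\<lambda>n. \<Sum>x\<leftarrow>xs. f x n)"
  using assms
  by (induction xs) (simp_all add: positive_hilbert_type_zero positive_hilbert_type_add)

text \<open>
  The coefficients that witness the property agree with the Hilbert coefficients, because two families
  that describe the same lengths differ by a family whose sum is eventually zero.
\<close>

lemma mixed_multiplicity_of_positive_hilbert_type:
  assumes len: "\<And>n. module_length A (graded_piece S M (Mg n)) = enat (f n)"
    and f: "positive_hilbert_type f"
    and top: "mixed_multiplicity_defined A S M Mg k"
  shows "0 \<le> hilbert_coeff A S M Mg k \<and>
    (\<forall>n. multi_difference k (hilbert_polynomial A S M Mg) n = of_int (hilbert_coeff A S M Mg k))"
proof -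
  obtain e N where e: "nonneg_top e"
      "\<And>n. (\<And>i. N \<le> n i) \<Longrightarrow> of_nat (f n) = binomial_sum e (\<lambda>i. of_nat (n i))"
    using f unfolding positive_hilbert_type_def by blast
  then have fin: "finite {k. e k \<noteq> 0}" by (simp add: nonneg_top_def)
  have e_coeffs: "is_hilbert_coeffs A S M Mg e"
    unfolding is_hilbert_coeffs_def using e fin by (auto simp: len)
  have "e' = e" if "is_hilbert_coeffs A S M Mg e'" for e'
  proof
    fix h
    from that have fin': "finite {k. e' k \<noteq> 0}"
      and "\<exists>N. \<forall>n. (\<forall>i. N \<le> n i) \<longrightarrow> of_nat (f n) = binomial_sum e' (\<lambda>i. of_nat (n i))"
      by (simp_all add: is_hilbert_coeffs_def len)
    then obtain N' where
      N': "\<And>n. (\<And>i. N' \<le> n i) \<Longrightarrow> of_nat (f n) = binomial_sum e' (\<lambda>i. of_nat (n i))"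
      by blast
    have "binomial_sum (\<lambda>h. e' h - e h) (\<lambda>i. of_nat (n i)) = 0" if "\<forall>i. max N N' \<le> n i" for n
      using that e(2)[of n] N'[of n] by (simp add: binomial_sum_diff[OF fin' fin])
    then have "eventually_zero (binomial_sum (\<lambda>h. e' h - e h))"
      unfolding eventually_zero_def by blast
    moreover have "finite {h. e' h - e h \<noteq> 0}"
      by (rule finite_subset[of _ "{k. e' k \<noteq> 0} \<union> {k. e k \<noteq> 0}"]) (auto simp: fin fin')
    ultimately have "e' h - e h = 0" by (rule binomial_sum_eventually_zero[rotated])
    then show "e' h = e h" by simp
  qed
  with e_coeffs have coeff: "hilbert_coeff A S M Mg = e"
    unfolding hilbert_coeff_def by (rule the_equality)
  have zero: "\<forall>h>k. e h = 0" using top by (simp add: mixed_multiplicity_defined_def coeff)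
  then have "0 \<le> e k" using e(1) by (simp add: nonneg_top_def)
  moreover have "multi_difference k (binomial_sum e) q = of_int (e k)" for q
    using zero by (intro multi_difference_top fin) auto
  ultimately show ?thesis by (simp add: hilbert_polynomial_def coeff)
qed

section \<open>Antitone functions on exponents\<close>

lemma nat_sequence_mono_subsequence:
  fixes s :: "nat \<Rightarrow> nat"
  obtains r :: "nat \<Rightarrow> nat" where "strict_mono r" "mono (\<lambda>n. s (r n))"
proof -
  obtain r :: "nat \<Rightarrow> nat" where r: "strict_mono r" "monoseq (\<lambda>n. s (r n))"
    using seq_monosub[of s] by blast
  show ?thesis
  proof (cases "incseq (\<lambda>n. s (r n))")
    case True
    with r(1) that show ?thesis by blast
  next
    case False
    then have dec: "antimono (\<lambda>n. s (r n))" using r(2) by (simp add: monoseq_iff)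
    obtain N where N: "\<And>n. s (r N) \<le> s (r n)"
      using ex_has_least_nat[of "\<lambda>_. True" 0 "\<lambda>n. s (r n)"] by auto
    have "s (r (n + N)) = s (r N)" for n
      using N[of "n + N"] antimonoD[OF dec, of N "n + N"] by simp
    then have "mono (\<lambda>n. s (r (n + N)))" by (simp add: mono_def)
    moreover have "strict_mono (\<lambda>n. r (n + N))" using r(1) by (simp add: strict_mono_def)
    ultimately show ?thesis using that by blast
  qed
qed

text \<open>
  Dickson's lemma in the form of a subsequence that increases in every coordinate of \<open>X\<close>; passing to a
  monotone subsequence once per coordinate preserves what was achieved before.
\<close>

lemma dickson:
  fixes s :: "nat \<Rightarrow> 'x \<Rightarrow> nat"
  assumes "finite X"
  obtains r :: "nat \<Rightarrow> nat" where "strict_mono r" "\<And>x. x \<in> X \<Longrightarrow> mono (\<lambda>n. s (r n) x)"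
proof -
  from assms have "\<exists>r::nat \<Rightarrow> nat. strict_mono r \<and> (\<forall>x\<in>X. mono (\<lambda>n. s (r n) x))"
  proof (induction X rule: finite_induct)
    case empty
    show ?case by (intro exI[of _ id]) (simp add: strict_mono_def)
  next
    case (insert y X)
    then obtain r :: "nat \<Rightarrow> nat" where r: "strict_mono r" "\<And>x. x \<in> X \<Longrightarrow> mono (\<lambda>n. s (r n) x)" by blast
    obtain r' :: "nat \<Rightarrow> nat" where r': "strict_mono r'" "mono (\<lambda>n. s (r (r' n)) y)"
      using nat_sequence_mono_subsequence[of "\<lambda>n. s (r n) y"] by blast
    have "mono (\<lambda>n. s (r (r' n)) x)" if "x \<in> X" for x
      using r(2)[OF that] strict_mono_mono[OF r'(1)] by (simp add: mono_def)
    with r r' show ?case by (intro exI[of _ "\<lambda>n. r (r' n)"]) (simp add: strict_mono_def)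
  qed
  with that show ?thesis by blast
qed

definition exponents :: "'x set \<Rightarrow> ('x \<Rightarrow> nat) set" where
  "exponents X = {a. \<forall>x. x \<notin> X \<longrightarrow> a x = 0}"

text \<open>
  The variable \<open>x\<close> has the unit vector with index \<open>\<delta> x\<close> as its degree.
\<close>

definition multidegree :: "('x \<Rightarrow> 'd) \<Rightarrow> 'x set \<Rightarrow> ('x \<Rightarrow> nat) \<Rightarrow> 'd \<Rightarrow> nat" where
  "multidegree \<delta> X a i = (\<Sum>x\<in>{x\<in>X. \<delta> x = i}. a x)"

text \<open>
  If the slices \<open>l(\<cdot>, t)\<close> kept decreasing, there would be infinitely many indices \<open>T\<^sub>n\<close> with an
  exponent \<open>a\<^sub>n\<close> at which \<open>l\<close> drops between \<open>T\<^sub>n\<close> and \<open>T\<^sub>n\<^sub>+\<^sub>1\<close>. Dickson's lemma, applied to the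
  exponents together with the values \<open>l(a\<^sub>n, T\<^sub>n)\<close>, yields two of them that increase in the exponent
  and in the value, which contradicts that \<open>l\<close> is antitone.
\<close>

lemma antitone_slices_stabilise:
  fixes l :: "('x \<Rightarrow> nat) \<Rightarrow> nat"
  assumes X: "finite X" "x \<notin> X" and anti: "antimono_on (exponents (insert x X)) l"
  obtains T where "\<And>t a. T \<le> t \<Longrightarrow> a \<in> exponents X \<Longrightarrow> l (a(x := t)) = l (a(x := T))"
proof (rule ccontr)
  assume "\<not> thesis"
  with that have bad: "\<exists>t a. T \<le> t \<and> a \<in> exponents X \<and> l (a(x := t)) \<noteq> l (a(x := T))" for T
    by blast
  have mem: "a(x := t) \<in> exponents (insert x X)" if "a \<in> exponents X" for a t
    using that by (auto simp: exponents_def)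
  have "\<exists>t. \<exists>a. T < t \<and> a \<in> exponents X \<and> l (a(x := t)) < l (a(x := T))" for T
  proof -
    obtain t a where ta: "T \<le> t" "a \<in> exponents X" "l (a(x := t)) \<noteq> l (a(x := T))"
      using bad by blast
    have "l (a(x := t)) \<le> l (a(x := T))"
      using ta by (intro monotone_onD[OF anti]) (auto simp: mem le_fun_def)
    moreover have "T \<noteq> t" using ta by auto
    ultimately show ?thesis using ta by (intro exI[of _ t] exI[of _ a]) auto
  qed
  then obtain nxt arg where step: "\<And>T. T < nxt T" "\<And>T. arg T \<in> exponents X"
    "\<And>T. l ((arg T)(x := nxt T)) < l ((arg T)(x := T))"
    by metis
  define T where "T n = (nxt ^^ n) 0" for n
  have T_Suc: "T (Suc n) = nxt (T n)" for n by (simp add: T_def)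
  have T: "strict_mono T" by (simp add: strict_mono_Suc_iff T_Suc step)
  \<comment> \<open>The coordinate \<open>x\<close>, where \<open>arg (T n)\<close> is zero, stores the value of \<open>l\<close>.\<close>
  define s where "s n = (arg (T n))(x := l ((arg (T n))(x := T n)))" for n
  obtain r :: "nat \<Rightarrow> nat" where r: "strict_mono r" "\<And>y. y \<in> insert x X \<Longrightarrow> mono (\<lambda>n. s (r n) y)"
    using dickson[of "insert x X" s] X by blast
  let ?i = "r 0" and ?j = "r 1"
  have ij: "?i < ?j" using r(1) by (simp add: strict_mono_def)
  have le: "s ?i y \<le> s ?j y" if "y \<in> insert x X" for y
    using r(2)[OF that] by (simp add: mono_def)
  have "(arg (T ?i))(x := T (Suc ?i)) \<le> (arg (T ?j))(x := T ?j)"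
    unfolding le_fun_def
  proof
    fix y
    consider "y = x" | "y \<in> X" "y \<noteq> x" | "y \<notin> insert x X" by blast
    then show "((arg (T ?i))(x := T (Suc ?i))) y \<le> ((arg (T ?j))(x := T ?j)) y"
    proof cases
      case 1
      have "Suc ?i \<le> ?j" using ij by simp
      then have "T (Suc ?i) \<le> T ?j" using strict_mono_mono[OF T] by (simp add: mono_def)
      with 1 show ?thesis by simp
    next
      case 2
      then show ?thesis using le[of y] by (simp add: s_def)
    next
      case 3
      then show ?thesis using step(2)[of "T ?i"] by (auto simp: exponents_def)
    qed
  qed
  then have "l ((arg (T ?j))(x := T ?j)) \<le> l ((arg (T ?i))(x := T (Suc ?i)))"
    by (intro monotone_onD[OF anti] mem step(2))
  also have "\<dots> < l ((arg (T ?i))(x := T ?i))" unfolding T_Suc by (rule step(3))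
  also have "\<dots> \<le> l ((arg (T ?j))(x := T ?j))" using le[of x] by (simp add: s_def)
  finally show False by simp
qed

text \<open>
  The number of monomials of degree \<open>t\<close> in \<open>f\<close> variables.
\<close>

definition count_monomials :: "nat \<Rightarrow> nat \<Rightarrow> nat" where
  "count_monomials f t = (case f of 0 \<Rightarrow> (if t = 0 then 1 else 0) | Suc g \<Rightarrow> (g + t) choose g)"

text \<open>
  The number of points of degree \<open>n\<close> in a cone whose apex has degree \<open>fst p\<close> and which has
  \<open>snd p i\<close> free variables of degree \<open>i\<close>. Only these two multi-indices matter for counting, so the
  cone itself is not recorded.
\<close>

definition cone_count :: "('d::finite \<Rightarrow> nat) \<times> ('d \<Rightarrow> nat) \<Rightarrow> ('d \<Rightarrow> nat) \<Rightarrow> nat" where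
  "cone_count p n = (if fst p \<le> n then \<Prod>i\<in>UNIV. count_monomials (snd p i) (n i - fst p i) else 0)"

lemma sum_count_monomials:
  "(\<Sum>t\<le>m. count_monomials f t) = count_monomials (Suc f) m"
proof (cases f)
  case 0
  then show ?thesis by (simp add: count_monomials_def)
next
  case (Suc g)
  then show ?thesis using choose_rising_sum(1)[of g m] by (simp add: count_monomials_def)
qed

lemma cone_count_translate:
  "cone_count (u + v, f) n = (if v \<le> n then cone_count (u, f) (n - v) else 0)"
proof -
  have "u + v \<le> n \<longleftrightarrow> v \<le> n \<and> u \<le> n - v"
  proof -
    have "u i + v i \<le> n i \<longleftrightarrow> v i \<le> n i \<and> u i \<le> n i - v i" for i by auto
    then show ?thesis by (auto simp: le_fun_def)
  qed
  moreover have "n i - (u i + v i) = n i - v i - u i" for i by simp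
  ultimately show ?thesis by (simp add: cone_count_def)
qed

definition index_unit :: "'d \<Rightarrow> nat \<Rightarrow> 'd \<Rightarrow> nat" where
  "index_unit i t = (\<lambda>j. if j = i then t else 0)"

lemma index_unit_le: "index_unit i t \<le> n \<longleftrightarrow> t \<le> n i"
  by (auto simp: index_unit_def le_fun_def)

text \<open>
  Adding a free variable of degree \<open>i\<close> to a cone sums the counts over the exponent \<open>t\<close> of the new
  variable.
\<close>

lemma sum_cone_count:
  fixes n :: "'d::finite \<Rightarrow> nat"
  shows "(\<Sum>t\<le>n i. cone_count (u, f) (n - index_unit i t)) = cone_count (u, f(i := Suc (f i))) n"
proof (cases "u \<le> n")
  case False
  then obtain j where "\<not> u j \<le> n j" by (auto simp: le_fun_def)
  then have "\<not> u j \<le> (n - index_unit i t) j" for t by simp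
  then have "\<not> u \<le> n - index_unit i t" for t by (auto simp: le_fun_def)
  with False show ?thesis by (simp add: cone_count_def)
next
  case True
  let ?R = "\<Prod>j\<in>UNIV - {i}. count_monomials (f j) (n j - u j)"
  have split: "(\<Prod>j\<in>UNIV. count_monomials (g j) (m j - u j)) =
      count_monomials (g i) (m i - u i) * ?R"
    if "\<And>j. j \<noteq> i \<Longrightarrow> g j = f j \<and> m j = n j" for g m
    using that by (subst prod.remove[of _ i]) (auto intro!: prod.cong)
  have ui: "u i \<le> n i" using True by (simp add: le_fun_def)
  have slice: "cone_count (u, f) (n - index_unit i t) =
      (if t \<le> n i - u i then count_monomials (f i) (n i - u i - t) * ?R else 0)"
    if "t \<le> n i" for t
  proof -
    have "u \<le> n - index_unit i t \<longleftrightarrow> t \<le> n i - u i"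
    proof
      assume "u \<le> n - index_unit i t"
      then have "u i \<le> n i - t" using le_funD[of u "n - index_unit i t" i] by (simp add: index_unit_def)
      with that ui show "t \<le> n i - u i" by simp
    next
      assume "t \<le> n i - u i"
      then have "u i \<le> n i - t" using ui by linarith
      then show "u \<le> n - index_unit i t"
        using True by (auto simp: le_fun_def index_unit_def)
    qed
    moreover have "(\<Prod>j\<in>UNIV. count_monomials (f j) ((n - index_unit i t) j - u j))
        = count_monomials (f i) (n i - u i - t) * ?R"
      by (subst split) (auto simp: index_unit_def add.commute)
    ultimately show ?thesis by (simp add: cone_count_def)
  qed
  have "(\<Sum>t\<le>n i. cone_count (u, f) (n - index_unit i t)) =
      (\<Sum>t\<le>n i - u i. count_monomials (f i) (n i - u i - t) * ?R)"
    by (rule sum.mono_neutral_cong_right) (auto simp: slice)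
  also have "\<dots> = (\<Sum>t\<le>n i - u i. count_monomials (f i) t) * ?R"
    unfolding sum_distrib_right
    by (rule sum.reindex_bij_witness[of _ "\<lambda>t. n i - u i - t" "\<lambda>t. n i - u i - t"]) auto
  also have "\<dots> = cone_count (u, f(i := Suc (f i))) n"
    using split[of "f(i := Suc (f i))" n] True by (simp add: sum_count_monomials cone_count_def)
  finally show ?thesis .
qed

lemma exponents_multidegree_le:
  assumes "finite X" "a \<in> exponents X"
  shows "a x \<le> (\<Sum>i\<in>UNIV. multidegree \<delta> X a (i::'d::finite))"
proof (cases "x \<in> X")
  case True
  then have "a x \<le> multidegree \<delta> X a (\<delta> x)"
    unfolding multidegree_def using assms by (intro member_le_sum) auto
  also have "\<dots> \<le> (\<Sum>i\<in>UNIV. multidegree \<delta> X a i)" by (rule member_le_sum) auto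
  finally show ?thesis .
qed (use assms in \<open>simp add: exponents_def\<close>)

lemma finite_exponents_of_degree:
  fixes n :: "'d::finite \<Rightarrow> nat"
  assumes "finite X"
  shows "finite {a \<in> exponents X. multidegree \<delta> X a = n}"
proof (rule finite_subset)
  let ?N = "\<Sum>i\<in>UNIV. n i"
  show "{a \<in> exponents X. multidegree \<delta> X a = n} \<subseteq>
      {a. \<forall>x. (x \<in> X \<longrightarrow> a x \<in> {..?N}) \<and> (x \<notin> X \<longrightarrow> a x = 0)}"
  proof
    fix a assume a: "a \<in> {a \<in> exponents X. multidegree \<delta> X a = n}"
    then have "a x \<le> ?N" for x
      using exponents_multidegree_le[OF assms, of a x \<delta>] by (simp only: mem_Collect_eq)
    with a show "a \<in> {a. \<forall>x. (x \<in> X \<longrightarrow> a x \<in> {..?N}) \<and> (x \<notin> X \<longrightarrow> a x = 0)}"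
      by (simp add: exponents_def)
  qed
  show "finite {a. \<forall>x. (x \<in> X \<longrightarrow> a x \<in> {..?N}) \<and> (x \<notin> X \<longrightarrow> a x = 0)}"
    using assms by (rule finite_set_of_finite_funs) simp
qed

lemma multidegree_add: "multidegree \<delta> X (a + b) = multidegree \<delta> X a + multidegree \<delta> X b"
  by (simp add: fun_eq_iff multidegree_def sum.distrib)

lemma multidegree_insert:
  assumes "finite X" "x \<notin> X"
  shows "multidegree \<delta> (insert x X) a = index_unit (\<delta> x) (a x) + multidegree \<delta> X a"
proof
  fix i
  show "multidegree \<delta> (insert x X) a i = (index_unit (\<delta> x) (a x) + multidegree \<delta> X a) i"
  proof (cases "\<delta> x = i")
    case True
    then have "{y \<in> insert x X. \<delta> y = i} = insert x {y\<in>X. \<delta> y = i}" by auto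
    with True assms show ?thesis by (simp add: multidegree_def index_unit_def)
  next
    case False
    then have "{y \<in> insert x X. \<delta> y = i} = {y\<in>X. \<delta> y = i}" by auto
    with False show ?thesis by (auto simp: multidegree_def index_unit_def)
  qed
qed

lemma multidegree_insert_fun_upd:
  assumes "finite X" "x \<notin> X"
  shows "multidegree \<delta> (insert x X) (a(x := t)) = multidegree \<delta> X a + index_unit (\<delta> x) t"
proof -
  have "multidegree \<delta> X (a(x := t)) = multidegree \<delta> X a"
    using assms(2) by (auto simp: fun_eq_iff multidegree_def intro!: sum.cong)
  then show ?thesis by (simp only: multidegree_insert[OF assms] fun_upd_same add.commute)
qed

lemma eq_diff_index:
  fixes m n u :: "'d \<Rightarrow> nat"
  assumes "u \<le> n"
  shows "m = n - u \<longleftrightarrow> m + u = n"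
proof -
  have "m i = n i - u i \<longleftrightarrow> m i + u i = n i" for i
    using le_funD[OF assms, of i] by linarith
  then show ?thesis by (simp add: fun_eq_iff)
qed

text \<open>
  The exponents are sorted by their value \<open>t\<close> at the new variable; this variable accounts for
  \<open>t\<close> units of the degree in direction \<open>\<delta> x\<close>.
\<close>

lemma sum_exponents_insert:
  fixes n :: "'d::finite \<Rightarrow> nat"
  assumes X: "finite X" "x \<notin> X"
  shows "(\<Sum>a\<in>{a \<in> exponents (insert x X). multidegree \<delta> (insert x X) a = n}. l a) =
    (\<Sum>t\<le>n (\<delta> x). \<Sum>a\<in>{a \<in> exponents X. multidegree \<delta> X a = n - index_unit (\<delta> x) t}. l (a(x := t)))"
proof -
  let ?E = "\<lambda>m. {a \<in> exponents X. multidegree \<delta> X a = m}"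
  let ?u = "index_unit (\<delta> x)"
  have deg: "multidegree \<delta> (insert x X) a = multidegree \<delta> X (a(x := 0)) + ?u (a x)"
    and mem: "a(x := 0) \<in> exponents X"
    if "a \<in> exponents (insert x X)" for a
  proof -
    show "a(x := 0) \<in> exponents X" using that by (auto simp: exponents_def)
    from multidegree_insert_fun_upd[OF X, of \<delta> "a(x := 0)" "a x"]
    show "multidegree \<delta> (insert x X) a = multidegree \<delta> X (a(x := 0)) + ?u (a x)" by simp
  qed
  have sub: "multidegree \<delta> X b = n - ?u t \<longleftrightarrow> multidegree \<delta> X b + ?u t = n"
    if "t \<le> n (\<delta> x)" for b t
    by (rule eq_diff_index) (simp add: index_unit_le that)
  have "(\<Sum>t\<le>n (\<delta> x). \<Sum>a\<in>?E (n - ?u t). l (a(x := t))) =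
      (\<Sum>(t, a)\<in>(SIGMA t:{..n (\<delta> x)}. ?E (n - ?u t)). l (a(x := t)))"
    by (rule sum.Sigma) (auto intro: finite_exponents_of_degree[OF X(1)])
  also have "\<dots> = (\<Sum>a\<in>{a \<in> exponents (insert x X). multidegree \<delta> (insert x X) a = n}. l a)"
  proof (rule sum.reindex_bij_witness[of _ "\<lambda>a. (a x, a(x := 0))" "\<lambda>(t, a). a(x := t)"])
    fix p assume "p \<in> (SIGMA t:{..n (\<delta> x)}. ?E (n - ?u t))"
    then obtain t a where p: "p = (t, a)" "t \<le> n (\<delta> x)" "a \<in> exponents X"
      "multidegree \<delta> X a + ?u t = n" using sub by auto
    then have ax: "a x = 0" using X by (simp add: exponents_def)
    then show "((case p of (t, a) \<Rightarrow> a(x := t)) x, (case p of (t, a) \<Rightarrow> a(x := t))(x := 0)) = p"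
      using p by auto
    have "multidegree \<delta> (insert x X) (a(x := t)) = n"
      by (simp only: multidegree_insert_fun_upd[OF X] p(4))
    moreover have "a(x := t) \<in> exponents (insert x X)" using p by (auto simp: exponents_def)
    ultimately show "(case p of (t, a) \<Rightarrow> a(x := t)) \<in>
        {a \<in> exponents (insert x X). multidegree \<delta> (insert x X) a = n}" using p by simp
    show "l (case p of (t, a) \<Rightarrow> a(x := t)) = (case p of (t, a) \<Rightarrow> l (a(x := t)))"
      using p by simp
  next
    fix a assume "a \<in> {a \<in> exponents (insert x X). multidegree \<delta> (insert x X) a = n}"
    then have a: "a \<in> exponents (insert x X)" "multidegree \<delta> X (a(x := 0)) + ?u (a x) = n"
      using deg by auto
    then have "a x \<le> n (\<delta> x)" by (auto simp: index_unit_def)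
    with a mem sub show "(a x, a(x := 0)) \<in> (SIGMA t:{..n (\<delta> x)}. ?E (n - ?u t))" by auto
    show "(case (a x, a(x := 0)) of (t, a) \<Rightarrow> a(x := t)) = a" by simp
  qed
  finally show ?thesis ..
qed

lemma sum_sum_list_swap: "(\<Sum>s\<in>A. \<Sum>p\<leftarrow>xs. h p s) = (\<Sum>p\<leftarrow>xs. \<Sum>s\<in>A. h p s)"
  for h :: "'a \<Rightarrow> 'b \<Rightarrow> nat"
  by (induction xs) (simp_all add: sum.distrib)

text \<open>
  Induction on the variables. The slices below the stabilisation index \<open>T\<close> contribute their cones,
  translated by \<open>t\<close>; all the slices from \<open>T\<close> on coincide, so each cone of the slice at \<open>T\<close> acquires
  the new variable as a free one.
\<close>

lemma antitone_sum_cone_counts: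
  fixes \<delta> :: "'x \<Rightarrow> 'd::finite"
  assumes "finite X" "antimono_on (exponents X) l"
  obtains L where "\<And>n. (\<Sum>a\<in>{a \<in> exponents X. multidegree \<delta> X a = n}. l a) = (\<Sum>p\<leftarrow>L. cone_count p n)"
proof -
  have "\<exists>L. \<forall>n. (\<Sum>a\<in>{a \<in> exponents X. multidegree \<delta> X a = n}. l a) = (\<Sum>p\<leftarrow>L. cone_count p n)"
    using assms
  proof (induction X arbitrary: l rule: finite_induct)
    case empty
    have zero: "exponents {} = {\<lambda>_::'x. 0}" by (auto simp: exponents_def)
    have deg: "multidegree \<delta> {} a = 0" for a by (simp add: multidegree_def fun_eq_iff)
    have "(\<Sum>a\<in>{a \<in> exponents {}. multidegree \<delta> {} a = n}. l a) =
        (\<Sum>p\<leftarrow>replicate (l (\<lambda>_. 0)) (0, 0). cone_count p n)" for n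
    proof -
      have "cone_count (0, 0) n = (if 0 = n then 1 else 0)"
        by (auto simp: cone_count_def count_monomials_def fun_eq_iff le_fun_def)
      moreover have "{a \<in> exponents {}. multidegree \<delta> {} a = n} = (if 0 = n then {\<lambda>_. 0} else {})"
        by (auto simp: zero deg)
      ultimately show ?thesis by (simp add: sum_list_replicate)
    qed
    then show ?case by blast
  next
    case (insert x X)
    let ?E = "\<lambda>n. {a \<in> exponents X. multidegree \<delta> X a = n}" and ?i = "\<delta> x"
    let ?u = "index_unit ?i"
    obtain T where T: "\<And>t a. T \<le> t \<Longrightarrow> a \<in> exponents X \<Longrightarrow> l (a(x := t)) = l (a(x := T))"
      using antitone_slices_stabilise[OF insert.hyps insert.prems] by blast
    have "antimono_on (exponents X) (\<lambda>a. l (a(x := t)))" for t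
    proof (rule monotone_onI)
      fix a b assume "a \<in> exponents X" "b \<in> exponents X" "a \<le> b"
      then show "l (b(x := t)) \<le> l (a(x := t))"
        by (intro monotone_onD[OF insert.prems]) (auto simp: exponents_def le_fun_def)
    qed
    from insert.IH[OF this] have "\<forall>t. \<exists>L. \<forall>n. (\<Sum>a\<in>?E n. l (a(x := t))) = (\<Sum>p\<leftarrow>L. cone_count p n)"
      by blast
    then obtain L where L: "\<And>t n. (\<Sum>a\<in>?E n. l (a(x := t))) = (\<Sum>p\<leftarrow>L t. cone_count p n)"
      by metis
    define shift where "shift t p = (fst p + ?u t, snd p)" for t and p :: "('d \<Rightarrow> nat) \<times> ('d \<Rightarrow> nat)"
    define free where "free p = (fst p, (snd p)(?i := Suc (snd p ?i)))"
      for p :: "('d \<Rightarrow> nat) \<times> ('d \<Rightarrow> nat)"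
    have shift: "cone_count (shift t p) n = (if t \<le> n ?i then cone_count p (n - ?u t) else 0)" for t p n
      by (simp add: shift_def cone_count_translate index_unit_le)
    have free: "cone_count (free p) n = (\<Sum>t\<le>n ?i. cone_count p (n - ?u t))" for p n
      using sum_cone_count[where n = n and i = ?i and u = "fst p" and f = "snd p"] by (simp add: free_def)
    let ?L = "concat (map (\<lambda>t. map (shift t) (L t)) [0..<T]) @ map (\<lambda>p. shift T (free p)) (L T)"
    have "(\<Sum>a\<in>{a \<in> exponents (insert x X). multidegree \<delta> (insert x X) a = n}. l a) =
        (\<Sum>p\<leftarrow>?L. cone_count p n)" for n
    proof -
      define g where "g t = (\<Sum>a\<in>?E (n - ?u t). l (a(x := t)))" for t
      have "(\<Sum>a\<in>{a \<in> exponents (insert x X). multidegree \<delta> (insert x X) a = n}. l a) =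
          (\<Sum>t\<le>n ?i. g t)"
        unfolding g_def by (rule sum_exponents_insert[OF insert.hyps])
      also have "\<dots> = (\<Sum>t\<in>{t. t < T \<and> t \<le> n ?i}. g t) + (\<Sum>t\<in>{T..n ?i}. g t)"
        by (subst sum.union_disjoint[symmetric]) (auto intro!: sum.cong)
      also have "(\<Sum>t\<in>{t. t < T \<and> t \<le> n ?i}. g t) = (\<Sum>t<T. \<Sum>p\<leftarrow>L t. cone_count (shift t p) n)"
        by (rule sum.mono_neutral_cong_left) (auto simp: shift g_def L)
      also have "\<dots> = (\<Sum>p\<leftarrow>concat (map (\<lambda>t. map (shift t) (L t)) [0..<T]). cone_count p n)"
        by (induction T) (simp_all add: comp_def)
      also have "(\<Sum>t\<in>{T..n ?i}. g t) = (\<Sum>p\<leftarrow>L T. cone_count (shift T (free p)) n)"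
      proof (cases "T \<le> n ?i")
        case False
        then show ?thesis by (simp add: shift)
      next
        case True
        have "g (T + s) = (\<Sum>p\<leftarrow>L T. cone_count p (n - ?u T - ?u s))" for s
        proof -
          have "n - ?u (T + s) = n - ?u T - ?u s" by (auto simp: index_unit_def fun_eq_iff)
          then show ?thesis unfolding g_def L[symmetric]
            by (intro sum.cong) (auto intro: T)
        qed
        moreover have "(\<Sum>t\<in>{T..n ?i}. g t) = (\<Sum>s\<le>n ?i - T. g (T + s))"
          using True by (intro sum.reindex_bij_witness[of _ "\<lambda>s. T + s" "\<lambda>t. t - T"]) auto
        ultimately have "(\<Sum>t\<in>{T..n ?i}. g t) =
            (\<Sum>s\<le>n ?i - T. \<Sum>p\<leftarrow>L T. cone_count p (n - ?u T - ?u s))" by simp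
        also have "\<dots> = (\<Sum>p\<leftarrow>L T. \<Sum>s\<le>n ?i - T. cone_count p (n - ?u T - ?u s))"
          by (rule sum_sum_list_swap)
        also have "\<dots> = (\<Sum>p\<leftarrow>L T. cone_count (free p) (n - ?u T))"
          by (simp add: free index_unit_def)
        also have "\<dots> = (\<Sum>p\<leftarrow>L T. cone_count (shift T (free p)) n)" using True by (simp add: shift)
        finally show ?thesis .
      qed
      finally show ?thesis by (simp add: comp_def)
    qed
    then show ?case by blast
  qed
  with that show ?thesis by blast
qed

text \<open>
  A cone without free variables of degree \<open>i\<close> has points of bounded \<open>i\<close>-th degree only. Otherwise
  the count is a translate of the basis element with index \<open>f - 1\<close>.
\<close>

lemma positive_hilbert_type_cone_count: "positive_hilbert_type (cone_count (u, f))"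
proof (cases "\<exists>i. f i = 0")
  case True
  then obtain i where i: "f i = 0" by blast
  have "cone_count (u, f) n = 0" if "\<forall>j. Suc (u i) \<le> n j" for n
  proof -
    have "count_monomials (f i) (n i - u i) = 0"
      using that[rule_format, of i] i by (simp add: count_monomials_def)
    then show ?thesis by (auto simp: cone_count_def intro!: prod_zero)
  qed
  then show ?thesis unfolding positive_hilbert_type_def
    by (intro exI[of _ "\<lambda>_. 0"] conjI exI[of _ "Suc (u i)"])
       (auto simp: nonneg_top_def binomial_sum_def)
next
  case False
  let ?k = "\<lambda>i. f i - 1"
  obtain e where e: "nonneg_top e"
    "\<And>q. binomial_sum e q = binomial_basis ?k (\<lambda>i. q i - of_nat (u i))"
    using nonneg_top_translate[OF nonneg_top_single[of ?k], of u] by (auto simp: binomial_sum_single)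
  have "of_nat (cone_count (u, f) n) = binomial_sum e (\<lambda>i. of_nat (n i))"
    if n: "\<forall>i. Max (range u) \<le> n i" for n
  proof -
    have le: "u i \<le> n i" for i
      using n order_trans[OF Max_ge[of "range u" "u i"]] by simp
    have "of_nat (count_monomials (f i) (n i - u i)) =
        ((of_nat (n i) - of_nat (u i) + of_nat (?k i) :: rat) gchoose ?k i)" for i
    proof (cases "f i")
      case 0
      with False show ?thesis by blast
    next
      case (Suc g)
      then show ?thesis
        using le[of i] by (simp add: count_monomials_def binomial_gbinomial of_nat_diff algebra_simps)
    qed
    then show ?thesis
      using le by (simp add: e(2) binomial_basis_def cone_count_def le_fun_def)
  qed
  with e(1) show ?thesis unfolding positive_hilbert_type_def by blast
qed

lemma positive_hilbert_type_antitone_sum: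
  fixes \<delta> :: "'x \<Rightarrow> 'd::finite" and \<gamma> :: "'g \<Rightarrow> 'd \<Rightarrow> nat"
  assumes X: "finite X" and G: "finite G"
    and anti: "\<And>g. g \<in> G \<Longrightarrow> antimono_on (exponents X) (l g)"
  shows "positive_hilbert_type (\<lambda>n.
    \<Sum>(a, g)\<in>{(a, g). a \<in> exponents X \<and> g \<in> G \<and> multidegree \<delta> X a + \<gamma> g = n}. l g a)"
proof -
  let ?E = "\<lambda>n. {a \<in> exponents X. multidegree \<delta> X a = n}"
  have "\<exists>L. \<forall>n. (\<Sum>a\<in>?E n. l g a) = (\<Sum>p\<leftarrow>L. cone_count p n)" if "g \<in> G" for g
    by (rule antitone_sum_cone_counts[OF X anti[OF that], of \<delta>]) blast
  then have "\<forall>g\<in>G. \<exists>L. \<forall>n. (\<Sum>a\<in>?E n. l g a) = (\<Sum>p\<leftarrow>L. cone_count p n)" by blast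
  from bchoice[OF this] obtain L where L: "\<And>g n. g \<in> G \<Longrightarrow> (\<Sum>a\<in>?E n. l g a) = (\<Sum>p\<leftarrow>L g. cone_count p n)"
    by blast
  have one: "positive_hilbert_type (\<lambda>n. \<Sum>a\<in>{a \<in> exponents X. multidegree \<delta> X a + \<gamma> g = n}. l g a)"
    if g: "g \<in> G" for g
  proof -
    have "(\<Sum>a\<in>{a \<in> exponents X. multidegree \<delta> X a + \<gamma> g = n}. l g a)
        = (\<Sum>p\<leftarrow>L g. cone_count (fst p + \<gamma> g, snd p) n)" for n
    proof (cases "\<gamma> g \<le> n")
      case True
      have "{a \<in> exponents X. multidegree \<delta> X a + \<gamma> g = n} = ?E (n - \<gamma> g)"
        using eq_diff_index[OF True] by blast
      then show ?thesis using True by (simp add: L[OF g] cone_count_translate)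
    next
      case False
      have "{a \<in> exponents X. multidegree \<delta> X a + \<gamma> g = n} = {}"
        using False by (auto simp: le_fun_def)
      then show ?thesis using False by (simp only: sum.empty) (simp add: cone_count_translate)
    qed
    then show ?thesis
      by (simp add: positive_hilbert_type_sum_list positive_hilbert_type_cone_count)
  qed
  have sum: "positive_hilbert_type (\<lambda>n. \<Sum>g\<in>F. \<Sum>a\<in>{a \<in> exponents X. multidegree \<delta> X a + \<gamma> g = n}. l g a)"
    if "F \<subseteq> G" for F
    using finite_subset[OF that G] that
    by (induction F rule: finite_induct)
       (simp_all add: positive_hilbert_type_zero positive_hilbert_type_add one)
  have "(\<Sum>(a, g)\<in>{(a, g). a \<in> exponents X \<and> g \<in> G \<and> multidegree \<delta> X a + \<gamma> g = n}. l g a)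
      = (\<Sum>g\<in>G. \<Sum>a\<in>{a \<in> exponents X. multidegree \<delta> X a + \<gamma> g = n}. l g a)" for n
  proof -
    have fin: "finite {a \<in> exponents X. multidegree \<delta> X a + \<gamma> g = n}" for g
      by (rule finite_subset[OF _ finite_exponents_of_degree[OF X, of \<delta> "n - \<gamma> g"]]) auto
    have "(\<Sum>g\<in>G. \<Sum>a\<in>{a \<in> exponents X. multidegree \<delta> X a + \<gamma> g = n}. l g a) =
      (\<Sum>(g, a)\<in>(SIGMA g:G. {a \<in> exponents X. multidegree \<delta> X a + \<gamma> g = n}). l g a)"
      by (rule sum.Sigma) (auto simp: G fin)
    also have "\<dots> = (\<Sum>(a, g)\<in>{(a, g). a \<in> exponents X \<and> g \<in> G \<and> multidegree \<delta> X a + \<gamma> g = n}. l g a)"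
      by (rule sum.reindex_bij_witness[of _ prod.swap prod.swap]) auto
    finally show ?thesis ..
  qed
  with sum[of G] show ?thesis by simp
qed

section \<open>Lengths of subquotients\<close>

text \<open>
  Subquotients \<open>V / U\<close> are represented by the pair \<open>U \<subseteq> V\<close>, and their submodules by the submodules
  between \<open>U\<close> and \<open>V\<close>. Then no quotient modules have to be built, and chains in \<open>V\<close>, in
  \<open>V / U\<close> and in graded pieces can be compared as chains of subsets.
\<close>

definition has_chain ::
  "('a, 'x) ring_scheme \<Rightarrow> ('a, 'm, 'z) module_scheme \<Rightarrow> 'm set \<Rightarrow> 'm set \<Rightarrow> nat \<Rightarrow> bool" where
  "has_chain R M U V l \<longleftrightarrow> (\<exists>C. (\<forall>i\<le>l. submodule (C i) R M \<and> U \<subseteq> C i \<and> C i \<subseteq> V) \<and>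
     (\<forall>i<l. C i \<subset> C (Suc i)))"

definition finite_length ::
  "('a, 'x) ring_scheme \<Rightarrow> ('a, 'm, 'z) module_scheme \<Rightarrow> 'm set \<Rightarrow> 'm set \<Rightarrow> bool" where
  "finite_length R M U V \<longleftrightarrow> (\<exists>b. \<forall>l. has_chain R M U V l \<longrightarrow> l \<le> b)"

text \<open>
  The maximum is only meaningful for pairs with \<open>finite_length\<close>.
\<close>

definition quotient_length ::
  "('a, 'x) ring_scheme \<Rightarrow> ('a, 'm, 'z) module_scheme \<Rightarrow> 'm set \<Rightarrow> 'm set \<Rightarrow> nat" where
  "quotient_length R M U V = Max {l. has_chain R M U V l}"

lemma has_chain_0: "submodule U R M \<Longrightarrow> U \<subseteq> V \<Longrightarrow> has_chain R M U V 0"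
  unfolding has_chain_def by (rule exI[of _ "\<lambda>_. U"]) simp

lemma has_chain_extend:
  assumes "has_chain R M U X l" "submodule Y R M" "X \<subset> Y" "Y \<subseteq> V"
  shows "has_chain R M U V (Suc l)"
proof -
  obtain C where C: "\<And>i. i \<le> l \<Longrightarrow> submodule (C i) R M \<and> U \<subseteq> C i \<and> C i \<subseteq> X"
    "\<And>i. i < l \<Longrightarrow> C i \<subset> C (Suc i)"
    using assms(1) unfolding has_chain_def by blast
  have UY: "U \<subseteq> Y" using C(1)[of l] assms(3) by blast
  show ?thesis unfolding has_chain_def
  proof (intro exI[of _ "C(Suc l := Y)"] conjI allI impI)
    fix i
    { assume "i \<le> Suc l"
      then show "submodule ((C(Suc l := Y)) i) R M" "U \<subseteq> (C(Suc l := Y)) i" "(C(Suc l := Y)) i \<subseteq> V"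
        using C(1)[of i] assms UY by (cases "i = Suc l"; fastforce)+ }
    assume "i < Suc l"
    then show "(C(Suc l := Y)) i \<subset> (C(Suc l := Y)) (Suc i)"
      using C(1)[of i] C(2)[of i] assms(3) by (cases "i = l") (auto simp: psubset_eq)
  qed
qed

lemma has_chain_trivial:
  assumes "has_chain R M U U l"
  shows "l = 0"
proof (rule ccontr)
  assume "l \<noteq> 0"
  obtain C where C: "\<forall>i\<le>l. submodule (C i) R M \<and> U \<subseteq> C i \<and> C i \<subseteq> U" "\<forall>i<l. C i \<subset> C (Suc i)"
    using assms unfolding has_chain_def by (elim exE conjE)
  from \<open>l \<noteq> 0\<close> have "0 < l" "1 \<le> l" by auto
  with C show False by (metis One_nat_def le0 psubset_eq subset_antisym)
qed

lemma has_chain_mono: "has_chain R M U V l \<Longrightarrow> U' \<subseteq> U \<Longrightarrow> V \<subseteq> V' \<Longrightarrow> has_chain R M U' V' l"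
  unfolding has_chain_def by (meson order_trans)

lemma finite_length_mono: "finite_length R M U' V' \<Longrightarrow> U' \<subseteq> U \<Longrightarrow> V \<subseteq> V' \<Longrightarrow> finite_length R M U V"
  unfolding finite_length_def by (meson has_chain_mono)

lemma has_chain_le_quotient_length:
  assumes "finite_length R M U V" "has_chain R M U V l"
  shows "l \<le> quotient_length R M U V"
proof -
  obtain b where "{l. has_chain R M U V l} \<subseteq> {..b}"
    using assms(1) by (auto simp: finite_length_def)
  then have "finite {l. has_chain R M U V l}" by (rule finite_subset) simp
  then show ?thesis unfolding quotient_length_def using assms(2) by (intro Max_ge) auto
qed

lemma has_chain_quotient_length:
  assumes "finite_length R M U V" "submodule U R M" "U \<subseteq> V"
  shows "has_chain R M U V (quotient_length R M U V)"
proof -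
  obtain b where "{l. has_chain R M U V l} \<subseteq> {..b}"
    using assms(1) by (auto simp: finite_length_def)
  then have "finite {l. has_chain R M U V l}" by (rule finite_subset) simp
  moreover have "{l. has_chain R M U V l} \<noteq> {}" using has_chain_0[OF assms(2,3)] by blast
  ultimately show ?thesis unfolding quotient_length_def using Max_in by blast
qed

lemma quotient_length_le:
  assumes "submodule U R M" "U \<subseteq> V" "\<And>l. has_chain R M U V l \<Longrightarrow> l \<le> b"
  shows "finite_length R M U V" "quotient_length R M U V \<le> b"
proof -
  show "finite_length R M U V" using assms(3) by (auto simp: finite_length_def)
  from has_chain_quotient_length[OF this assms(1,2)] show "quotient_length R M U V \<le> b"
    by (rule assms(3))
qed

lemma quotient_length_strict_mono:
  assumes fin: "finite_length R M U Y" and U: "submodule U R M" "U \<subseteq> X"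
    and Y: "submodule Y R M" "X \<subset> Y"
  shows "quotient_length R M U X < quotient_length R M U Y"
proof -
  have "finite_length R M U X" by (rule finite_length_mono[OF fin]) (use Y in auto)
  from has_chain_quotient_length[OF this U]
  have "has_chain R M U Y (Suc (quotient_length R M U X))"
    by (rule has_chain_extend[OF _ Y subset_refl])
  from has_chain_le_quotient_length[OF fin this] show ?thesis by simp
qed

lemma quotient_length_mono:
  assumes fin: "finite_length R M U Y" and U: "submodule U R M" "U \<subseteq> X"
    and Y: "submodule Y R M" "X \<subseteq> Y"
  shows "quotient_length R M U X \<le> quotient_length R M U Y"
  using quotient_length_strict_mono[OF fin U Y(1)] Y(2) unfolding subset_iff_psubset_eq
  by (auto intro: less_imp_le)

text \<open>
  Any strictly monotone map between two intervals of submodules compares lengths; it need not come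
  from a homomorphism of the modules.
\<close>

lemma has_chain_transfer:
  assumes "has_chain R M U V l"
    and F: "\<And>X. submodule X R M \<Longrightarrow> U \<subseteq> X \<Longrightarrow> X \<subseteq> V \<Longrightarrow>
      submodule (F X) R' M' \<and> U' \<subseteq> F X \<and> F X \<subseteq> V'"
    and strict: "\<And>X Y. submodule X R M \<Longrightarrow> submodule Y R M \<Longrightarrow> U \<subseteq> X \<Longrightarrow> X \<subset> Y \<Longrightarrow> Y \<subseteq> V \<Longrightarrow>
      F X \<subset> F Y"
  shows "has_chain R' M' U' V' l"
proof -
  obtain C where C: "\<And>i. i \<le> l \<Longrightarrow> submodule (C i) R M \<and> U \<subseteq> C i \<and> C i \<subseteq> V"
    "\<And>i. i < l \<Longrightarrow> C i \<subset> C (Suc i)"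
    using assms(1) unfolding has_chain_def by blast
  show ?thesis unfolding has_chain_def
  proof (intro exI[of _ "\<lambda>i. F (C i)"] conjI allI impI)
    fix i
    { assume "i \<le> l"
      then show "submodule (F (C i)) R' M'" "U' \<subseteq> F (C i)" "F (C i) \<subseteq> V'" using F C(1) by blast+ }
    assume "i < l"
    then show "F (C i) \<subset> F (C (Suc i))" using C(1)[of i] C(1)[of "Suc i"] C(2)[of i]
      by (intro strict) auto
  qed
qed

context module
begin

lemma submodule_zero: "submodule {\<zero>\<^bsub>M\<^esub>} R M"
  by (rule submoduleI) auto

lemma submodule_zero_mem: "submodule H R M \<Longrightarrow> \<zero>\<^bsub>M\<^esub> \<in> H"
  using subgroup.one_closed[OF submodule.axioms(1)] by fastforce

lemma submodule_zero_subset: "submodule H R M \<Longrightarrow> {\<zero>\<^bsub>M\<^esub>} \<subseteq> H"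
  using submodule_zero_mem by blast

lemma submodule_minus: "submodule H R M \<Longrightarrow> x \<in> H \<Longrightarrow> y \<in> H \<Longrightarrow> x \<ominus>\<^bsub>M\<^esub> y \<in> H"
  by (simp add: a_minus_def submoduleE)

lemma submodule_Inter:
  assumes "\<And>H. H \<in> F \<Longrightarrow> submodule H R M" "F \<noteq> {}"
  shows "submodule (\<Inter>F) R M"
proof (rule submoduleI)
  show "\<Inter>F \<subseteq> carrier M" using assms submoduleE(1) by blast
qed (use assms in \<open>auto simp: submoduleE submodule_zero_mem\<close>)

lemma submodule_Int: "submodule H R M \<Longrightarrow> submodule K R M \<Longrightarrow> submodule (H \<inter> K) R M"
  using submodule_Inter[of "{H, K}"] by auto

definition submodule_sum :: "'c set \<Rightarrow> 'c set \<Rightarrow> 'c set" where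
  "submodule_sum H K = {x. \<exists>h\<in>H. \<exists>k\<in>K. x = h \<oplus>\<^bsub>M\<^esub> k}"

lemma submodule_submodule_sum:
  assumes H: "submodule H R M" and K: "submodule K R M"
  shows "submodule (submodule_sum H K) R M"
proof (rule submoduleI)
  note sub = subsetD[OF submoduleE(1)[OF H]] subsetD[OF submoduleE(1)[OF K]]
  show "submodule_sum H K \<subseteq> carrier M" by (auto simp: submodule_sum_def sub)
  show "\<zero>\<^bsub>M\<^esub> \<in> submodule_sum H K"
    unfolding submodule_sum_def using submodule_zero_mem[OF H] submodule_zero_mem[OF K]
    by (auto intro!: bexI[of _ "\<zero>\<^bsub>M\<^esub>"])
  fix x assume "x \<in> submodule_sum H K"
  then obtain h k where hk: "h \<in> H" "k \<in> K" "x = h \<oplus>\<^bsub>M\<^esub> k" by (auto simp: submodule_sum_def)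
  have "\<ominus>\<^bsub>M\<^esub> x = \<ominus>\<^bsub>M\<^esub> h \<oplus>\<^bsub>M\<^esub> \<ominus>\<^bsub>M\<^esub> k" using hk by (simp add: sub M.minus_add)
  then show "\<ominus>\<^bsub>M\<^esub> x \<in> submodule_sum H K"
    unfolding submodule_sum_def using submoduleE(3)[OF H hk(1)] submoduleE(3)[OF K hk(2)] by blast
  { fix y assume "y \<in> submodule_sum H K"
    then obtain h' k' where hk': "h' \<in> H" "k' \<in> K" "y = h' \<oplus>\<^bsub>M\<^esub> k'" by (auto simp: submodule_sum_def)
    have "x \<oplus>\<^bsub>M\<^esub> y = (h \<oplus>\<^bsub>M\<^esub> h') \<oplus>\<^bsub>M\<^esub> (k \<oplus>\<^bsub>M\<^esub> k')"
      using hk hk' by (simp add: sub M.a_ac)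
    then show "x \<oplus>\<^bsub>M\<^esub> y \<in> submodule_sum H K"
      unfolding submodule_sum_def
      using submoduleE(5)[OF H hk(1) hk'(1)] submoduleE(5)[OF K hk(2) hk'(2)] by blast }
  fix a assume a: "a \<in> carrier R"
  have "a \<odot>\<^bsub>M\<^esub> x = a \<odot>\<^bsub>M\<^esub> h \<oplus>\<^bsub>M\<^esub> a \<odot>\<^bsub>M\<^esub> k" using a hk by (simp add: sub smult_r_distr)
  then show "a \<odot>\<^bsub>M\<^esub> x \<in> submodule_sum H K"
    unfolding submodule_sum_def using submoduleE(4)[OF H a hk(1)] submoduleE(4)[OF K a hk(2)] by blast
qed

lemma submodule_sum_upper1: "submodule H R M \<Longrightarrow> submodule K R M \<Longrightarrow> H \<subseteq> submodule_sum H K"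
proof
  fix x assume "submodule H R M" "submodule K R M" "x \<in> H"
  then have "x = x \<oplus>\<^bsub>M\<^esub> \<zero>\<^bsub>M\<^esub>" "\<zero>\<^bsub>M\<^esub> \<in> K" using subsetD[OF submoduleE(1)] submodule_zero_mem by auto
  with \<open>x \<in> H\<close> show "x \<in> submodule_sum H K" unfolding submodule_sum_def by blast
qed

lemma submodule_sum_upper2: "submodule H R M \<Longrightarrow> submodule K R M \<Longrightarrow> K \<subseteq> submodule_sum H K"
proof
  fix x assume "submodule H R M" "submodule K R M" "x \<in> K"
  then have "x = \<zero>\<^bsub>M\<^esub> \<oplus>\<^bsub>M\<^esub> x" "\<zero>\<^bsub>M\<^esub> \<in> H" using subsetD[OF submoduleE(1)] submodule_zero_mem by auto
  with \<open>x \<in> K\<close> show "x \<in> submodule_sum H K" unfolding submodule_sum_def by blast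
qed

lemma submodule_sum_least: "submodule L R M \<Longrightarrow> H \<subseteq> L \<Longrightarrow> K \<subseteq> L \<Longrightarrow> submodule_sum H K \<subseteq> L"
  unfolding submodule_sum_def using submoduleE(5)[of L] by blast

text \<open>
  The modular law: a submodule is determined, among those comparable with it, by its intersection and
  its sum with \<open>V\<close>.
\<close>

lemma modular_strict:
  assumes V: "submodule V R M" and X: "submodule X R M" and Y: "submodule Y R M" and less: "X \<subset> Y"
  shows "X \<inter> V \<subset> Y \<inter> V \<or> submodule_sum V X \<subset> submodule_sum V Y"
proof (rule ccontr)
  assume "\<not> ?thesis"
  moreover have "X \<inter> V \<subseteq> Y \<inter> V" "submodule_sum V X \<subseteq> submodule_sum V Y"
    using less by (auto simp: submodule_sum_def)
  ultimately have eq: "X \<inter> V = Y \<inter> V" "submodule_sum V X = submodule_sum V Y" by auto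
  have "Y \<subseteq> X"
  proof
    fix y assume y: "y \<in> Y"
    then have "y \<in> submodule_sum V X" using eq(2) submodule_sum_upper2[OF V Y] by blast
    then obtain v x where vx: "v \<in> V" "x \<in> X" "y = v \<oplus>\<^bsub>M\<^esub> x" by (auto simp: submodule_sum_def)
    have car: "v \<in> carrier M" "x \<in> carrier M" using vx submoduleE(1)[OF V] submoduleE(1)[OF X] by auto
    have "v = y \<ominus>\<^bsub>M\<^esub> x" using car vx(3) by (simp add: a_minus_def M.a_assoc M.r_neg)
    then have "v \<in> Y" using submodule_minus[OF Y y] vx(2) less by blast
    then have "v \<in> X" using vx(1) eq(1) by blast
    then show "y \<in> X" using vx submoduleE(5)[OF X] by blast
  qed
  with less show False by blast
qed

lemma has_chain_append:
  assumes UV: "has_chain R M U V l" and V: "submodule V R M" and VW: "has_chain R M V W m"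
  shows "has_chain R M U W (l + m)"
proof -
  obtain C where C: "\<And>i. i \<le> m \<Longrightarrow> submodule (C i) R M \<and> V \<subseteq> C i \<and> C i \<subseteq> W"
    "\<And>i. i < m \<Longrightarrow> C i \<subset> C (Suc i)"
    using VW unfolding has_chain_def by blast
  have "has_chain R M U (C i) (l + i)" if "i \<le> m" for i
    using that
  proof (induction i)
    case 0
    then show ?case using has_chain_mono[OF UV] C(1)[of 0] by simp
  next
    case (Suc i)
    then show ?case
      using has_chain_extend[of R M U "C i" "l + i" "C (Suc i)" "C (Suc i)"] C(1)[of "Suc i"] C(2)[of i]
      by simp
  qed
  from this[of m] show ?thesis using has_chain_mono C(1)[of m] by blast
qed

text \<open>
  For the upper bound, the function \<open>h\<close> that adds the length of \<open>X \<inter> V\<close> over \<open>U\<close> and the length of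
  \<open>V + X\<close> over \<open>V\<close> strictly increases along any chain from \<open>U\<close> to \<open>W\<close>, by the modular law, and it
  is bounded by the sum of the two lengths.
\<close>

lemma quotient_length_additive:
  assumes U: "submodule U R M" and V: "submodule V R M" and W: "submodule W R M"
    and UV: "U \<subseteq> V" and VW: "V \<subseteq> W"
    and fin: "finite_length R M U V" "finite_length R M V W"
  shows "finite_length R M U W"
    and "quotient_length R M U W = quotient_length R M U V + quotient_length R M V W"
proof -
  define h where "h X = quotient_length R M U (X \<inter> V) + quotient_length R M V (submodule_sum V X)" for X
  have mono: "h X < h Y"
    if "submodule X R M" "submodule Y R M" "U \<subseteq> X" "X \<subset> Y" "Y \<subseteq> W" for X Y
  proof -
    have sub: "U \<subseteq> X \<inter> V" "submodule (X \<inter> V) R M" "submodule (Y \<inter> V) R M" "X \<inter> V \<subseteq> Y \<inter> V"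
      using that UV submodule_Int[OF that(1) V] submodule_Int[OF that(2) V] by blast+
    have sub': "V \<subseteq> submodule_sum V X" "submodule (submodule_sum V Y) R M"
      "submodule_sum V X \<subseteq> submodule_sum V Y"
      using submodule_sum_upper1[OF V that(1)] submodule_submodule_sum[OF V that(2)] that(4)
      by (simp_all only:) (auto simp: submodule_sum_def)
    have f1: "finite_length R M U (Y \<inter> V)" by (rule finite_length_mono[OF fin(1)]) auto
    have f2: "finite_length R M V (submodule_sum V Y)"
      by (rule finite_length_mono[OF fin(2) subset_refl submodule_sum_least[OF W VW that(5)]])
    show ?thesis
      using modular_strict[OF V that(1,2,4)]
    proof
      assume "X \<inter> V \<subset> Y \<inter> V"
      from add_less_le_mono[OF quotient_length_strict_mono[OF f1 U sub(1,3) this]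
          quotient_length_mono[OF f2 V sub']]
      show ?thesis by (simp only: h_def)
    next
      assume "submodule_sum V X \<subset> submodule_sum V Y"
      from add_le_less_mono[OF quotient_length_mono[OF f1 U sub(1,3,4)]
          quotient_length_strict_mono[OF f2 V sub'(1,2) this]]
      show ?thesis by (simp only: h_def)
    qed
  qed
  have bound: "l \<le> quotient_length R M U V + quotient_length R M V W" if l: "has_chain R M U W l" for l
  proof -
    obtain C where C: "\<And>i. i \<le> l \<Longrightarrow> submodule (C i) R M \<and> U \<subseteq> C i \<and> C i \<subseteq> W"
      "\<And>i. i < l \<Longrightarrow> C i \<subset> C (Suc i)"
      using l unfolding has_chain_def by blast
    have "i \<le> h (C i)" if "i \<le> l" for i
      using that
    proof (induction i)
      case (Suc i)
      then have "h (C i) < h (C (Suc i))"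
        using C(1)[of i] C(1)[of "Suc i"] C(2)[of i] by (intro mono) auto
      with Suc show ?case by simp
    qed simp
    then have "l \<le> h (C l)" by simp
    also have "\<dots> \<le> quotient_length R M U V + quotient_length R M V W"
      unfolding h_def
    proof (rule add_mono)
      show "quotient_length R M U (C l \<inter> V) \<le> quotient_length R M U V"
        using C(1)[of l] UV by (intro quotient_length_mono fin U V) auto
      show "quotient_length R M V (submodule_sum V (C l)) \<le> quotient_length R M V W"
        using C(1)[of l] VW
        by (intro quotient_length_mono fin V W submodule_sum_upper1 submodule_sum_least) auto
    qed
    finally show ?thesis .
  qed
  show fUW: "finite_length R M U W" using bound by (auto simp: finite_length_def)
  have "has_chain R M U W (quotient_length R M U V + quotient_length R M V W)"
    by (rule has_chain_append[OF has_chain_quotient_length[OF fin(1) U UV] V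
        has_chain_quotient_length[OF fin(2) V VW]])
  then have "quotient_length R M U V + quotient_length R M V W \<le> quotient_length R M U W"
    by (rule has_chain_le_quotient_length[OF fUW])
  moreover have "quotient_length R M U W \<le> quotient_length R M U V + quotient_length R M V W"
    by (rule bound[OF has_chain_quotient_length[OF fUW U]]) (use UV VW in auto)
  ultimately show "quotient_length R M U W = quotient_length R M U V + quotient_length R M V W" by simp
qed

definition submodule_span :: "'c set \<Rightarrow> 'c set" where
  "submodule_span B = (\<lambda>H. submodule H R M) hull B"

lemma submodule_submodule_span:
  assumes "B \<subseteq> carrier M"
  shows "submodule (submodule_span B) R M"
  unfolding submodule_span_def hull_def
  by (rule submodule_Inter) (use assms carrier_is_submodule in auto)

lemma submodule_span_superset: "B \<subseteq> submodule_span B"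
  unfolding submodule_span_def by (rule hull_subset)

lemma submodule_span_minimal: "B \<subseteq> H \<Longrightarrow> submodule H R M \<Longrightarrow> submodule_span B \<subseteq> H"
  unfolding submodule_span_def by (rule hull_minimal)

definition multiples :: "'c \<Rightarrow> 'c set" where
  "multiples y = (\<lambda>a. a \<odot>\<^bsub>M\<^esub> y) ` carrier R"

lemma submodule_multiples:
  assumes y: "y \<in> carrier M"
  shows "submodule (multiples y) R M"
proof (rule submoduleI)
  show "\<zero>\<^bsub>M\<^esub> \<in> multiples y" unfolding multiples_def using y by (intro image_eqI[of _ _ \<zero>]) auto
  fix x assume "x \<in> multiples y"
  then obtain a where a: "a \<in> carrier R" "x = a \<odot>\<^bsub>M\<^esub> y" by (auto simp: multiples_def)
  then show "\<ominus>\<^bsub>M\<^esub> x \<in> multiples y"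
    unfolding multiples_def using y by (intro image_eqI[of _ _ "\<ominus> a"]) (auto simp: smult_l_minus)
  { fix z assume "z \<in> multiples y"
    then obtain b where "b \<in> carrier R" "z = b \<odot>\<^bsub>M\<^esub> y" by (auto simp: multiples_def)
    with a show "x \<oplus>\<^bsub>M\<^esub> z \<in> multiples y"
      unfolding multiples_def using y by (intro image_eqI[of _ _ "a \<oplus> b"]) (auto simp: smult_l_distr) }
  fix b assume "b \<in> carrier R"
  with a show "b \<odot>\<^bsub>M\<^esub> x \<in> multiples y"
    unfolding multiples_def using y by (intro image_eqI[of _ _ "b \<otimes> a"]) (auto simp: smult_assoc1)
qed (use y in \<open>auto simp: multiples_def\<close>)

lemma multiples_self: "y \<in> carrier M \<Longrightarrow> y \<in> multiples y"
  unfolding multiples_def by (intro image_eqI[of _ _ \<one>]) auto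

lemma submodule_span_insert:
  assumes "B \<subseteq> carrier M" "y \<in> carrier M"
  shows "submodule_span (insert y B) = submodule_sum (submodule_span B) (multiples y)"
proof
  note subs = submodule_submodule_span[OF assms(1)] submodule_multiples[OF assms(2)]
  show "submodule_span (insert y B) \<subseteq> submodule_sum (submodule_span B) (multiples y)"
    using submodule_sum_upper1[OF subs] submodule_sum_upper2[OF subs] submodule_span_superset[of B]
      multiples_self[OF assms(2)]
    by (intro submodule_span_minimal submodule_submodule_sum subs) blast
  have sub: "submodule (submodule_span (insert y B)) R M" by (rule submodule_submodule_span) (use assms in auto)
  have "y \<in> submodule_span (insert y B)" using submodule_span_superset[of "insert y B"] by blast
  then have "multiples y \<subseteq> submodule_span (insert y B)"
    unfolding multiples_def using submoduleE(4)[OF sub] by blast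
  moreover have "submodule_span B \<subseteq> submodule_span (insert y B)"
    using submodule_span_superset[of "insert y B"] sub by (intro submodule_span_minimal) auto
  ultimately show "submodule_sum (submodule_span B) (multiples y) \<subseteq> submodule_span (insert y B)"
    by (intro submodule_sum_least sub)
qed

text \<open>
  The generators \<open>v b\<close> are adjoined one at a time in the order of their keys, and additivity collects
  the length added in each step. The keys are passed as a function so that the same order can be
  used on index sets of every degree.
\<close>

lemma quotient_length_span_chain:
  fixes \<kappa> :: "'idx \<Rightarrow> 'k::linorder"
  assumes "finite B" "inj_on \<kappa> B" "v ` B \<subseteq> carrier M"
    and "\<And>b. b \<in> B \<Longrightarrow> finite_length R M (submodule_span (v ` {c\<in>B. \<kappa> c < \<kappa> b}))
      (submodule_span (v ` {c\<in>B. \<kappa> c \<le> \<kappa> b}))"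
  shows "finite_length R M {\<zero>\<^bsub>M\<^esub>} (submodule_span (v ` B)) \<and>
    quotient_length R M {\<zero>\<^bsub>M\<^esub>} (submodule_span (v ` B)) =
      (\<Sum>b\<in>B. quotient_length R M (submodule_span (v ` {c\<in>B. \<kappa> c < \<kappa> b}))
        (submodule_span (v ` {c\<in>B. \<kappa> c \<le> \<kappa> b})))"
  using assms
proof (induction B rule: finite_ranking_induct[where f = \<kappa>])
  case empty
  have "submodule_span {} = {\<zero>\<^bsub>M\<^esub>}"
    using submodule_span_minimal[OF _ submodule_zero, of "{}"]
      submodule_zero_subset[OF submodule_submodule_span[of "{}"]] by auto
  then show ?case
    using quotient_length_le[OF submodule_zero subset_refl, of 0] has_chain_trivial by fastforce
next
  case (insert x S)
  show ?case
  proof (cases "x \<in> S")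
    case True
    then have eq: "insert x S = S" by (rule insert_absorb)
    show ?thesis using insert.prems unfolding eq by (rule insert.IH)
  next
    case False
    let ?span = "submodule_span"
    have less: "\<kappa> y < \<kappa> x" if "y \<in> S" for y
      using insert.hyps(2)[OF that] insert.prems(1) False that by (auto simp: inj_on_def order_less_le)
    have lower: "{c \<in> insert x S. \<kappa> c < \<kappa> b} = {c \<in> S. \<kappa> c < \<kappa> b}"
      "{c \<in> insert x S. \<kappa> c \<le> \<kappa> b} = {c \<in> S. \<kappa> c \<le> \<kappa> b}" if "b \<in> S" for b
      using less[OF that] by auto
    have top: "{c \<in> insert x S. \<kappa> c < \<kappa> x} = S" "{c \<in> insert x S. \<kappa> c \<le> \<kappa> x} = insert x S"
      using less by (auto intro: less_imp_le)
    have finS: "finite_length R M (?span (v ` {c\<in>S. \<kappa> c < \<kappa> b})) (?span (v ` {c\<in>S. \<kappa> c \<le> \<kappa> b}))"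
      if "b \<in> S" for b
      using insert.prems(3)[of b] that unfolding lower[OF that] by blast
    have IH: "finite_length R M {\<zero>\<^bsub>M\<^esub>} (?span (v ` S))"
      "quotient_length R M {\<zero>\<^bsub>M\<^esub>} (?span (v ` S)) =
        (\<Sum>b\<in>S. quotient_length R M (?span (v ` {c\<in>S. \<kappa> c < \<kappa> b})) (?span (v ` {c\<in>S. \<kappa> c \<le> \<kappa> b})))"
      using insert.IH[OF _ _ finS] insert.prems(1,2) by (simp_all add: inj_on_insert)
    have subs: "submodule (?span (v ` S)) R M" "submodule (?span (v ` insert x S)) R M"
      using insert.prems(2) by (auto intro!: submodule_submodule_span)
    have "?span (v ` S) \<subseteq> ?span (v ` insert x S)"
      using submodule_span_superset[of "v ` insert x S"] subs by (intro submodule_span_minimal) auto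
    note add = quotient_length_additive[OF submodule_zero subs submodule_zero_subset[OF subs(1)] this IH(1)]
    have fin: "finite_length R M (?span (v ` S)) (?span (v ` insert x S))"
      using insert.prems(3)[of x] unfolding top by simp
    let ?f = "\<lambda>T b. quotient_length R M (?span (v ` {c\<in>T. \<kappa> c < \<kappa> b})) (?span (v ` {c\<in>T. \<kappa> c \<le> \<kappa> b}))"
    have "(\<Sum>b\<in>insert x S. ?f (insert x S) b) = ?f (insert x S) x + (\<Sum>b\<in>S. ?f (insert x S) b)"
      using insert.hyps(1) False by (rule sum.insert)
    also have "(\<Sum>b\<in>S. ?f (insert x S) b) = (\<Sum>b\<in>S. ?f S b)"
      by (rule sum.cong[OF refl]) (simp only: lower)
    finally show ?thesis
      using add[OF fin] IH(2) by (simp only: top simp_thms add.commute)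
  qed
qed

text \<open>
  A linear map \<open>f\<close> with \<open>f(W) \<subseteq> W'\<close> induces a map from \<open>(W + R y) / W\<close> onto
  \<open>(W' + R f(y)) / W'\<close>, and taking preimages of submodules is strictly monotone.
\<close>

lemma quotient_length_cyclic_map:
  assumes N: "module R N"
    and f: "\<And>x. x \<in> carrier M \<Longrightarrow> f x \<in> carrier N"
      "\<And>x y. x \<in> carrier M \<Longrightarrow> y \<in> carrier M \<Longrightarrow> f (x \<oplus>\<^bsub>M\<^esub> y) = f x \<oplus>\<^bsub>N\<^esub> f y"
      "\<And>a x. a \<in> carrier R \<Longrightarrow> x \<in> carrier M \<Longrightarrow> f (a \<odot>\<^bsub>M\<^esub> x) = a \<odot>\<^bsub>N\<^esub> f x"
    and W: "submodule W R M" and W': "submodule W' R N" and WW': "f ` W \<subseteq> W'"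
    and y: "y \<in> carrier M"
    and fin: "finite_length R M W (submodule_sum W (multiples y))"
  shows "finite_length R N W' (module.submodule_sum N W' (module.multiples R N (f y)))"
    and "quotient_length R N W' (module.submodule_sum N W' (module.multiples R N (f y)))
      \<le> quotient_length R M W (submodule_sum W (multiples y))"
proof -
  interpret N: module R N by (rule N)
  let ?V = "submodule_sum W (multiples y)" and ?V' = "N.submodule_sum W' (N.multiples (f y))"
  have V: "submodule ?V R M" by (intro submodule_submodule_sum W submodule_multiples y)
  have WV: "W \<subseteq> ?V" by (rule submodule_sum_upper1[OF W submodule_multiples[OF y]])
  have yV: "a \<odot>\<^bsub>M\<^esub> y \<in> ?V" if "a \<in> carrier R" for a
    using submodule_sum_upper2[OF W submodule_multiples[OF y]] that by (auto simp: multiples_def)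
  have car: "x \<in> carrier M" if "x \<in> ?V" for x using that submoduleE(1)[OF V] by blast
  have f0: "f \<zero>\<^bsub>M\<^esub> = \<zero>\<^bsub>N\<^esub>"
    using f(3)[OF R.zero_closed M.zero_closed] f(1)[OF M.zero_closed] by simp
  have fminus: "f (\<ominus>\<^bsub>M\<^esub> x) = \<ominus>\<^bsub>N\<^esub> f x" if "x \<in> carrier M" for x
    using f(2)[of x "\<ominus>\<^bsub>M\<^esub> x"] f(1) that f0
    by (metis M.a_inv_closed M.r_neg N.M.minus_equality N.M.a_comm)
  define F where "F X = {x \<in> ?V. f x \<in> X}" for X
  have bound: "l \<le> quotient_length R M W ?V" if "has_chain R N W' ?V' l" for l
  proof (rule has_chain_le_quotient_length[OF fin has_chain_transfer[OF that]])
    fix X assume X: "submodule X R N" "W' \<subseteq> X"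
    have "submodule (F X) R M"
    proof (rule submoduleI)
      show "F X \<subseteq> carrier M" using car by (auto simp: F_def)
    qed (use X f car V in \<open>auto simp: F_def f0 fminus submodule_zero_mem N.submodule_zero_mem
          submoduleE N.submoduleE\<close>)
    moreover have "W \<subseteq> F X" using WV WW' X(2) by (auto simp: F_def)
    ultimately show "submodule (F X) R M \<and> W \<subseteq> F X \<and> F X \<subseteq> ?V" by (auto simp: F_def)
    fix Z assume Z: "submodule Z R N" "X \<subset> Z" "Z \<subseteq> ?V'"
    then obtain z where z: "z \<in> Z" "z \<notin> X" by blast
    then have "z \<in> ?V'" using Z by blast
    then obtain w a where wa: "w \<in> W'" "a \<in> carrier R" "z = w \<oplus>\<^bsub>N\<^esub> a \<odot>\<^bsub>N\<^esub> f y"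
      by (auto simp: N.submodule_sum_def N.multiples_def)
    have wcar: "w \<in> carrier N" using wa N.submoduleE(1)[OF W'] by blast
    have fay: "f (a \<odot>\<^bsub>M\<^esub> y) = a \<odot>\<^bsub>N\<^esub> f y" using f(3) wa y by blast
    have "a \<odot>\<^bsub>N\<^esub> f y = z \<ominus>\<^bsub>N\<^esub> w"
      using wcar wa f(1)[OF y] by (simp add: a_minus_def N.M.a_comm N.M.a_assoc N.M.r_neg2 N.M.r_neg1)
    then have "f (a \<odot>\<^bsub>M\<^esub> y) \<in> Z"
      using N.submodule_minus[OF Z(1) z(1)] wa(1) X(2) Z(2) fay by auto
    moreover have "f (a \<odot>\<^bsub>M\<^esub> y) \<notin> X"
      using N.submoduleE(5)[OF X(1)] wa X(2) z(2) fay by auto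
    ultimately show "F X \<subset> F Z" using Z(2) yV[OF wa(2)] by (auto simp: F_def)
  qed
  have "W' \<subseteq> ?V'"
    by (rule N.submodule_sum_upper1[OF W' N.submodule_multiples[OF f(1)[OF y]]])
  from quotient_length_le[OF W' this bound]
  show "finite_length R N W' ?V'" "quotient_length R N W' ?V' \<le> quotient_length R M W ?V" by auto
qed

end

text \<open>
  The regular module. Its length is the length of the ring, and its submodules are the ideals.
\<close>

definition ring_module :: "('a, 'x) ring_scheme \<Rightarrow> ('a, 'a) module" where
  "ring_module R = \<lparr>carrier = carrier R, monoid.mult = monoid.mult R, one = \<one>\<^bsub>R\<^esub>,
     zero = \<zero>\<^bsub>R\<^esub>, add = add R, smult = monoid.mult R\<rparr>"

lemma ring_module_simps [simp]:
  "carrier (ring_module R) = carrier R" "zero (ring_module R) = \<zero>\<^bsub>R\<^esub>"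
  "add (ring_module R) = add R" "smult (ring_module R) = monoid.mult R"
  by (simp_all add: ring_module_def)

lemma (in cring) module_ring_module: "module R (ring_module R)"
proof (rule moduleI)
  show "abelian_group (ring_module R)"
    by (rule abelian_groupI) (auto simp: a_ac intro: bexI[of _ "\<ominus> x" for x] l_neg)
qed (auto simp: is_cring l_distr r_distr m_assoc)

lemma a_inv_ring_module [simp]: "a_inv (ring_module R) = a_inv R"
  by (simp add: a_inv_def ring_module_def fun_eq_iff m_inv_def)

section \<open>Artinian rings have finite length\<close>

context cring
begin

lemma ideal_of_submodule:
  assumes "submodule I R (ring_module R)"
  shows "ideal I R"
proof -
  interpret N: module R "ring_module R" by (rule module_ring_module)
  note I = N.submoduleE[OF assms, simplified] N.submodule_zero_mem[OF assms, simplified]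
  show ?thesis
  proof (rule idealI[OF ring_axioms])
    show "subgroup I (add_monoid R)"
      by (rule subgroup.intro) (use I in \<open>auto simp: a_inv_def\<close>)
    show "\<And>a x. a \<in> I \<Longrightarrow> x \<in> carrier R \<Longrightarrow> x \<otimes> a \<in> I" using I(4) by blast
    show "\<And>a x. a \<in> I \<Longrightarrow> x \<in> carrier R \<Longrightarrow> a \<otimes> x \<in> I" using I(1,4) m_comm by (metis subsetD)
  qed
qed

lemma artinian_minimal_submodule:
  assumes dcc: "\<And>I. \<lbrakk>\<And>n::nat. ideal (I n) R; \<And>n. I (Suc n) \<subseteq> I n\<rbrakk> \<Longrightarrow> \<exists>N. \<forall>n\<ge>N. I n = I N"
    and P: "submodule I0 R (ring_module R)" "Q I0"
  obtains J where "submodule J R (ring_module R)" "Q J"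
    "\<And>K. submodule K R (ring_module R) \<Longrightarrow> K \<subset> J \<Longrightarrow> \<not> Q K"
proof (rule ccontr)
  assume "\<not> thesis"
  with that have "\<forall>J. submodule J R (ring_module R) \<and> Q J \<longrightarrow>
      (\<exists>K. submodule K R (ring_module R) \<and> Q K \<and> K \<subset> J)" by blast
  then obtain next_J where nxt: "\<And>J. submodule J R (ring_module R) \<Longrightarrow> Q J \<Longrightarrow>
      submodule (next_J J) R (ring_module R) \<and> Q (next_J J) \<and> next_J J \<subset> J" by metis
  define I where "I n = (next_J ^^ n) I0" for n
  have I: "submodule (I n) R (ring_module R) \<and> Q (I n)" for n
    by (induction n) (use P nxt in \<open>auto simp: I_def\<close>)
  have less: "I (Suc n) \<subset> I n" for n using nxt[of "I n"] I[of n] by (simp add: I_def)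
  have "\<exists>N. \<forall>n\<ge>N. I n = I N" using I less by (intro dcc) (auto intro: ideal_of_submodule)
  then obtain N where N: "\<forall>n\<ge>N. I n = I N" by blast
  have "I (Suc N) = I N" by (rule N[rule_format]) simp
  with less[of N] show False by simp
qed

text \<open>
  Under these assumptions \<open>J\<close> behaves like a vector space: every scalar annihilates \<open>J\<close> or acts on it
  invertibly. For a vector \<open>v \<noteq> 0\<close>, a maximal submodule \<open>U\<close> that avoids \<open>v\<close> has codimension one, as
  \<open>v \<in> U + R y\<close> implies \<open>y \<in> U + R v\<close>. Hence \<open>J\<close> is longer by one than its proper submodule \<open>U\<close>.
\<close>

lemma finite_length_of_scalars_invertible:
  assumes J: "submodule J R (ring_module R)"
    and inv: "\<And>x. x \<in> carrier R \<Longrightarrow> \<exists>j\<in>J. x \<otimes> j \<noteq> \<zero> \<Longrightarrow> \<exists>r\<in>carrier R. \<forall>j\<in>J. r \<otimes> (x \<otimes> j) = j"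
    and proper: "\<And>K. submodule K R (ring_module R) \<Longrightarrow> K \<subset> J \<Longrightarrow> finite_length R (ring_module R) {\<zero>} K"
  shows "finite_length R (ring_module R) {\<zero>} J"
proof (cases "J = {\<zero>}")
  case True
  then show ?thesis unfolding finite_length_def by (auto dest: has_chain_trivial intro: exI[of _ 0])
next
  case False
  interpret N: module R "ring_module R" by (rule module_ring_module)
  note sub = N.submoduleE[simplified]
  have "\<zero> \<in> J" using N.submodule_zero_mem[OF J] by simp
  with False obtain v where v: "v \<in> J" "v \<noteq> \<zero>" by blast
  let ?A = "{U. submodule U R (ring_module R) \<and> U \<subseteq> J \<and> v \<notin> U}"
  have "{\<zero>} \<in> ?A" using N.submodule_zero \<open>\<zero> \<in> J\<close> v by auto
  moreover have "\<Union>C \<in> ?A" if C: "C \<noteq> {}" "subset.chain ?A C" for C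
  proof -
    have mem: "submodule U R (ring_module R)" "U \<subseteq> J" "v \<notin> U" if "U \<in> C" for U
      using C(2) that by (auto simp: subset.chain_def)
    have "submodule (\<Union>C) R (ring_module R)"
    proof (rule N.submoduleI)
      show "\<Union>C \<subseteq> carrier (ring_module R)" using mem(1) N.submoduleE(1) by blast
      show "\<zero>\<^bsub>ring_module R\<^esub> \<in> \<Union>C" using C(1) mem(1) N.submodule_zero_mem by blast
      fix a b assume ab: "a \<in> \<Union>C" "b \<in> \<Union>C"
      then obtain U V where UV: "U \<in> C" "V \<in> C" "a \<in> U" "b \<in> V" by blast
      then have "U \<subseteq> V \<or> V \<subseteq> U" using C(2) by (auto simp: subset.chain_def)
      then obtain W where "W \<in> C" "a \<in> W" "b \<in> W" using UV by blast
      then show "a \<oplus>\<^bsub>ring_module R\<^esub> b \<in> \<Union>C" using N.submoduleE(5)[OF mem(1)] by blast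
    next
      fix a assume "a \<in> \<Union>C"
      then show "\<ominus>\<^bsub>ring_module R\<^esub> a \<in> \<Union>C" using N.submoduleE(3)[OF mem(1)] by blast
    next
      fix a x assume "a \<in> carrier R" "x \<in> \<Union>C"
      then show "a \<odot>\<^bsub>ring_module R\<^esub> x \<in> \<Union>C" using N.submoduleE(4)[OF mem(1)] by blast
    qed
    then show ?thesis using mem by blast
  qed
  ultimately have "\<exists>U\<in>?A. \<forall>X\<in>?A. U \<subseteq> X \<longrightarrow> X = U"
    by (intro subset_Zorn_nonempty) (blast, assumption)
  then obtain U where U: "submodule U R (ring_module R)" "U \<subseteq> J" "v \<notin> U"
    and max: "\<And>X. submodule X R (ring_module R) \<Longrightarrow> X \<subseteq> J \<Longrightarrow> v \<notin> X \<Longrightarrow> U \<subseteq> X \<Longrightarrow> X = U"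
    by auto
  have top: "X = J" if X: "submodule X R (ring_module R)" "U \<subset> X" "X \<subseteq> J" for X
  proof (rule ccontr)
    assume "X \<noteq> J"
    then obtain y where y: "y \<in> J" "y \<notin> X" using X by blast
    have vX: "v \<in> X" using max[OF X(1,3)] X(2) by blast
    have ycar: "y \<in> carrier R" using y sub(1)[OF J] by blast
    note mult_y = N.submodule_multiples[of y, simplified, OF ycar]
    let ?Y = "N.submodule_sum U (N.multiples y)"
    have "y \<in> ?Y" using N.submodule_sum_upper2[OF U(1) mult_y] N.multiples_self[of y] ycar by auto
    moreover have "U \<subseteq> ?Y" by (rule N.submodule_sum_upper1[OF U(1) mult_y])
    moreover have "?Y \<subseteq> J"
    proof (rule N.submodule_sum_least[OF J U(2)])
      show "N.multiples y \<subseteq> J" using sub(4)[OF J _ y(1)] by (auto simp: N.multiples_def)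
    qed
    ultimately have "v \<in> ?Y"
      using max[OF N.submodule_submodule_sum[OF U(1) mult_y]] y(2) X(2) by blast
    then obtain u r where ur: "u \<in> U" "r \<in> carrier R" "v = u \<oplus> r \<otimes> y"
      by (auto simp: N.submodule_sum_def N.multiples_def)
    have car: "u \<in> carrier R" using ur(1) sub(1)[OF U(1)] by blast
    have "r \<otimes> y \<noteq> \<zero>" using ur U(3) car by auto
    then obtain s where s: "s \<in> carrier R" "s \<otimes> (r \<otimes> y) = y" using inv[OF ur(2)] y(1) by blast
    \<comment> \<open>Exchange: \<open>v\<close> lies in \<open>U + R y\<close>, and \<open>r\<close> can be inverted on \<open>y\<close>.\<close>
    have sv: "s \<otimes> v = y \<oplus> s \<otimes> u" using s ur car ycar by (simp add: r_distr a_comm)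
    have "y = s \<otimes> v \<ominus> s \<otimes> u"
      unfolding sv using s car ycar by (simp add: a_minus_def a_assoc r_neg)
    moreover have "s \<otimes> v \<in> X" "s \<otimes> u \<in> X" using sub(4)[OF X(1) s(1)] vX ur(1) X(2) by auto
    ultimately have "y \<in> X"
      using N.submodule_minus[OF X(1), of "s \<otimes> v" "s \<otimes> u"] by (simp add: a_minus_def)
    with y show False by simp
  qed
  have "l \<le> 1" if l: "has_chain R (ring_module R) U J l" for l
  proof (rule ccontr)
    assume "\<not> l \<le> 1"
    obtain C where C: "\<And>i. i \<le> l \<Longrightarrow> submodule (C i) R (ring_module R) \<and> U \<subseteq> C i \<and> C i \<subseteq> J"
      "\<And>i. i < l \<Longrightarrow> C i \<subset> C (Suc i)"
      using l unfolding has_chain_def by blast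
    have "U \<subset> C 1" "C 1 \<subset> C 2" "C 2 \<subseteq> J" "submodule (C 1) R (ring_module R)"
      using C(1)[of 0] C(1)[of 1] C(1)[of 2] C(2)[of 0] C(2)[of 1] \<open>\<not> l \<le> 1\<close>
      by (auto simp: numeral_2_eq_2)
    with top[of "C 1"] show False by blast
  qed
  then have "finite_length R (ring_module R) U J" by (auto simp: finite_length_def)
  moreover have "finite_length R (ring_module R) {\<zero>} U" using U v by (intro proper) auto
  ultimately show ?thesis
    using N.quotient_length_additive(1)[OF N.submodule_zero U(1) J N.submodule_zero_subset[OF U(1)] U(2)]
    by simp
qed

text \<open>
  If the length were infinite, the descending chain condition would give an ideal \<open>J\<close> that is minimal
  among those of infinite length. For a scalar \<open>x\<close>, the image \<open>x J \<cong> J / K\<close> and the kernel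
  \<open>K\<close> cannot both have finite length, so \<open>x J = J\<close> or \<open>K = J\<close>: a scalar that does not annihilate
  \<open>J\<close> is surjective on \<open>J\<close>. The chain of the ideals \<open>R x\<^sup>n\<close> stabilises, which makes such an \<open>x\<close>
  invertible on \<open>J\<close>. So \<open>J\<close> is a vector space all of whose proper subspaces have finite length,
  and it has finite length itself, a contradiction.
\<close>

theorem artinian_finite_length:
  assumes dcc: "\<And>I. \<lbrakk>\<And>n::nat. ideal (I n) R; \<And>n. I (Suc n) \<subseteq> I n\<rbrakk> \<Longrightarrow> \<exists>N. \<forall>n\<ge>N. I n = I N"
  shows "finite_length R (ring_module R) {\<zero>} (carrier R)"
proof (rule ccontr)
  interpret N: module R "ring_module R" by (rule module_ring_module)
  note sub = N.submoduleE[simplified]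
  assume "\<not> ?thesis"
  then obtain J where J: "submodule J R (ring_module R)" "\<not> finite_length R (ring_module R) {\<zero>} J"
    and proper: "\<And>K. submodule K R (ring_module R) \<Longrightarrow> K \<subset> J \<Longrightarrow> finite_length R (ring_module R) {\<zero>} K"
    using artinian_minimal_submodule[OF dcc, of "carrier R" "\<lambda>J. \<not> finite_length R (ring_module R) {\<zero>} J"]
      N.carrier_is_submodule by auto
  note car = subsetD[OF sub(1)[OF J(1)]]
  have image: "submodule ((\<otimes>) x ` K) R (ring_module R)"
    if x: "x \<in> carrier R" and K: "submodule K R (ring_module R)" for x K
  proof (rule N.submoduleI)
    note Kcar = subsetD[OF sub(1)[OF K]]
    show "(\<otimes>) x ` K \<subseteq> carrier (ring_module R)" using x Kcar by auto
    show "\<zero>\<^bsub>ring_module R\<^esub> \<in> (\<otimes>) x ` K"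
      using x N.submodule_zero_mem[OF K] by (intro image_eqI[of _ _ \<zero>]) auto
    fix a assume "a \<in> (\<otimes>) x ` K"
    then obtain k where k: "k \<in> K" "a = x \<otimes> k" by blast
    show "\<ominus>\<^bsub>ring_module R\<^esub> a \<in> (\<otimes>) x ` K"
      using sub(3)[OF K k(1)] k x Kcar by (intro image_eqI[of _ _ "\<ominus> k"]) (auto simp: r_minus)
    { fix b assume "b \<in> (\<otimes>) x ` K"
      then obtain k' where k': "k' \<in> K" "b = x \<otimes> k'" by blast
      show "a \<oplus>\<^bsub>ring_module R\<^esub> b \<in> (\<otimes>) x ` K"
        using sub(5)[OF K k(1) k'(1)] k k' x Kcar
        by (intro image_eqI[of _ _ "k \<oplus> k'"]) (auto simp: r_distr) }
    fix r assume "r \<in> carrier R"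
    then show "r \<odot>\<^bsub>ring_module R\<^esub> a \<in> (\<otimes>) x ` K"
      using sub(4)[OF K _ k(1)] k x Kcar
      by (intro image_eqI[of _ _ "r \<otimes> k"]) (auto simp: m_lcomm)
  qed
  have surj: "(\<otimes>) x ` J = J" if x: "x \<in> carrier R" "\<exists>j\<in>J. x \<otimes> j \<noteq> \<zero>" for x
  proof (rule ccontr)
    assume ne: "(\<otimes>) x ` J \<noteq> J"
    have "(\<otimes>) x ` J \<subseteq> J" using sub(4)[OF J(1) x(1)] by blast
    with ne have fin: "finite_length R (ring_module R) {\<zero>} ((\<otimes>) x ` J)"
      by (intro proper image x J(1)) blast
    define K where "K = {j\<in>J. x \<otimes> j = \<zero>}"
    have K: "submodule K R (ring_module R)"
    proof (rule N.submoduleI)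
      show "K \<subseteq> carrier (ring_module R)" using car by (auto simp: K_def)
    qed (use x(1) car sub[OF J(1)] N.submodule_zero_mem[OF J(1)]
        in \<open>auto simp: K_def r_minus r_distr m_lcomm[of x]\<close>)
    have finK: "finite_length R (ring_module R) {\<zero>} K"
      by (rule proper[OF K]) (use x(2) in \<open>auto simp: K_def\<close>)
    have "l \<le> quotient_length R (ring_module R) {\<zero>} ((\<otimes>) x ` J)"
      if "has_chain R (ring_module R) K J l" for l
    proof (rule has_chain_le_quotient_length[OF fin has_chain_transfer[OF that, where F = "(`) ((\<otimes>) x)"]])
      fix X assume X: "submodule X R (ring_module R)" "K \<subseteq> X"
      { assume "X \<subseteq> J"
        with X show "submodule ((\<otimes>) x ` X) R (ring_module R) \<and> {\<zero>} \<subseteq> (\<otimes>) x ` X \<and> (\<otimes>) x ` X \<subseteq> (\<otimes>) x ` J"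
          using image[OF x(1) X(1)] N.submodule_zero_subset by fastforce }
      fix Y assume Y: "submodule Y R (ring_module R)" "X \<subset> Y" "Y \<subseteq> J"
      then obtain y where y: "y \<in> Y" "y \<notin> X" by blast
      have "x \<otimes> y \<notin> (\<otimes>) x ` X"
      proof
        assume "x \<otimes> y \<in> (\<otimes>) x ` X"
        then obtain z where z: "z \<in> X" "x \<otimes> y = x \<otimes> z" by blast
        have c: "y \<in> carrier R" "z \<in> carrier R" using y z Y(2,3) car by auto
        have "x \<otimes> (y \<ominus> z) = \<zero>"
          using c x(1) z(2) by (simp add: a_minus_def r_distr r_minus r_neg)
        moreover have yz: "y \<ominus> z \<in> Y"
          using N.submodule_minus[OF Y(1) y(1)] z(1) Y(2) by (auto simp: a_minus_def)
        ultimately have "y \<ominus> z \<in> X" using X(2) Y(3) by (auto simp: K_def)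
        then have "(y \<ominus> z) \<oplus> z \<in> X" using sub(5)[OF X(1) _ z(1)] by blast
        moreover have "(y \<ominus> z) \<oplus> z = y" using c by (simp add: a_minus_def a_assoc l_neg)
        ultimately show False using y(2) by simp
      qed
      with y(1) Y(2) show "(\<otimes>) x ` X \<subset> (\<otimes>) x ` Y" by blast
    qed
    then have "finite_length R (ring_module R) K J" by (auto simp: finite_length_def)
    moreover have "K \<subseteq> J" by (auto simp: K_def)
    ultimately show False
      using N.quotient_length_additive(1)[OF N.submodule_zero K J(1) N.submodule_zero_subset[OF K]] finK J(2)
      by simp
  qed
  have inv: "\<exists>r\<in>carrier R. \<forall>j\<in>J. r \<otimes> (x \<otimes> j) = j"
    if x: "x \<in> carrier R" "\<exists>j\<in>J. x \<otimes> j \<noteq> \<zero>" for x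
  proof -
    have power: "(\<otimes>) (x [^] n) ` J = J" for n :: nat
    proof (induction n)
      case (Suc n)
      have "(\<otimes>) (x [^] Suc n) ` J = (\<otimes>) (x [^] n) ` ((\<otimes>) x ` J)"
        unfolding image_image using x car by (intro image_cong) (auto simp: m_assoc)
      then show ?case by (simp only: surj[OF x] Suc)
    next
      case 0
      have "(\<otimes>) (x [^] (0::nat)) ` J = (\<lambda>j. j) ` J" using car by (intro image_cong) auto
      then show ?case by simp
    qed
    have "\<exists>N. \<forall>n\<ge>N. N.multiples (x [^] (n::nat)) = N.multiples (x [^] N)"
    proof (rule dcc)
      show "ideal (N.multiples (x [^] n)) R" for n :: nat
        using x N.submodule_multiples[of "x [^] n"] by (intro ideal_of_submodule) auto
      fix n :: nat
      show "N.multiples (x [^] Suc n) \<subseteq> N.multiples (x [^] n)"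
      proof
        fix y assume "y \<in> N.multiples (x [^] Suc n)"
        then obtain a where "a \<in> carrier R" "y = a \<otimes> (x [^] n \<otimes> x)" by (auto simp: N.multiples_def)
        then have "a \<otimes> x \<in> carrier R" "y = (a \<otimes> x) \<otimes> x [^] n" using x by (auto simp: m_ac)
        then show "y \<in> N.multiples (x [^] n)" by (auto simp: N.multiples_def)
      qed
    qed
    then obtain n :: nat where n: "\<forall>m\<ge>n. N.multiples (x [^] m) = N.multiples (x [^] n)" by blast
    have "N.multiples (x [^] Suc n) = N.multiples (x [^] n)"
      using n by (elim allE[of _ "Suc n"] impE) simp_all
    moreover have "x [^] Suc n = x [^] n \<otimes> x" by simp
    moreover have "x [^] n \<in> N.multiples (x [^] n)"
      using N.multiples_self[of "x [^] n"] x(1) by simp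
    ultimately have "x [^] n \<in> N.multiples (x [^] n \<otimes> x)" by (simp only:)
    then obtain r where r: "r \<in> carrier R" "x [^] n = r \<otimes> (x [^] n \<otimes> x)"
      by (auto simp: N.multiples_def)
    have "r \<otimes> (x \<otimes> j) = j" if "j \<in> J" for j
    proof -
      have "j \<in> (\<otimes>) (x [^] n) ` J" unfolding power by (rule that)
      then obtain i where i: "i \<in> J" "j = x [^] n \<otimes> i" by (elim imageE)
      have "r \<otimes> (x \<otimes> (x [^] n \<otimes> i)) = (r \<otimes> (x [^] n \<otimes> x)) \<otimes> i"
        using r(1) x(1) car[OF i(1)] by (simp add: m_ac)
      also have "r \<otimes> (x [^] n \<otimes> x) = x [^] n" by (rule r(2)[symmetric])
      finally show ?thesis by (simp only: i(2))
    qed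
    with r show ?thesis by blast
  qed
  from finite_length_of_scalars_invertible[OF J(1) inv proper] J(2) show False by blast
qed

end

section \<open>Monomials in the generators of a multigraded algebra\<close>

lemma generate_ring_finite_support:
  assumes "s \<in> generate_ring S (K \<union> D)"
  obtains F where "finite F" "F \<subseteq> D" "s \<in> generate_ring S (K \<union> F)"
proof -
  have mono: "generate_ring S H \<subseteq> generate_ring S H'" if "H \<subseteq> H'" for H H'
  proof
    fix x assume "x \<in> generate_ring S H"
    then show "x \<in> generate_ring S H'"
      by induction (use that in \<open>auto intro: generate_ring.intros\<close>)
  qed
  from assms have "\<exists>F. finite F \<and> F \<subseteq> D \<and> s \<in> generate_ring S (K \<union> F)"
  proof induction
    case one
    then show ?case by (intro exI[of _ "{}"]) (auto intro: generate_ring.one)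
  next
    case (incl h)
    then have "finite ({h} \<inter> D)" "{h} \<inter> D \<subseteq> D" "h \<in> generate_ring S (K \<union> {h} \<inter> D)"
      by (auto intro: generate_ring.incl)
    then show ?case by blast
  next
    case (a_inv h)
    then show ?case by (auto intro: generate_ring.a_inv)
  next
    case (eng_add h1 h2)
    then obtain F1 F2 where F: "finite F1" "F1 \<subseteq> D" "h1 \<in> generate_ring S (K \<union> F1)"
      "finite F2" "F2 \<subseteq> D" "h2 \<in> generate_ring S (K \<union> F2)" by blast
    then have "h1 \<in> generate_ring S (K \<union> (F1 \<union> F2))" "h2 \<in> generate_ring S (K \<union> (F1 \<union> F2))"
      using mono[of "K \<union> F1" "K \<union> (F1 \<union> F2)"] mono[of "K \<union> F2" "K \<union> (F1 \<union> F2)"] by auto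
    with F show ?case by (intro exI[of _ "F1 \<union> F2"]) (auto intro: generate_ring.eng_add)
  next
    case (eng_mult h1 h2)
    then obtain F1 F2 where F: "finite F1" "F1 \<subseteq> D" "h1 \<in> generate_ring S (K \<union> F1)"
      "finite F2" "F2 \<subseteq> D" "h2 \<in> generate_ring S (K \<union> F2)" by blast
    then have "h1 \<in> generate_ring S (K \<union> (F1 \<union> F2))" "h2 \<in> generate_ring S (K \<union> (F1 \<union> F2))"
      using mono[of "K \<union> F1" "K \<union> (F1 \<union> F2)"] mono[of "K \<union> F2" "K \<union> (F1 \<union> F2)"] by auto
    with F show ?case by (intro exI[of _ "F1 \<union> F2"]) (auto intro: generate_ring.eng_mult)
  qed
  with that show ?thesis by blast
qed

lemma degree_one_index:
  fixes n :: "'d::finite \<Rightarrow> nat"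
  assumes "(\<Sum>i\<in>UNIV. n i) = 1"
  obtains i where "n = index_unit i 1"
proof -
  obtain i where "n i = 1" "\<And>j. i \<noteq> j \<Longrightarrow> n j = 0"
    using assms sum_eq_1_iff[of UNIV n] by auto
  then have "n = index_unit i 1" by (auto simp: index_unit_def fun_eq_iff)
  with that show ?thesis by blast
qed

context standard_multigraded_algebra
begin

lemma Sg_carrier: "s \<in> Sg n \<Longrightarrow> s \<in> carrier S"
  using decomposition unfolding internal_direct_sum_def
  by (metis subgroup.mem_carrier partial_object.select_convs(1))

lemma one_degree_zero: "\<one>\<^bsub>S\<^esub> \<in> Sg 0"
  using scalars_degree_zero[OF R.one_closed] by simp

text \<open>
  Each member of a finite generating set is a polynomial in finitely many elements of degree one, and
  these together generate the algebra.
\<close>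

lemma finite_degree_one_generators:
  obtains X \<delta> where "finite X" "\<And>x. x \<in> X \<Longrightarrow> x \<in> Sg (index_unit (\<delta> x) 1)"
    "generated_subalgebra A S X = carrier S"
proof -
  let ?K = "(\<lambda>a. a \<odot>\<^bsub>S\<^esub> \<one>\<^bsub>S\<^esub>) ` carrier A" and ?D = "\<Union>n\<in>{n. (\<Sum>i\<in>UNIV. n i) = 1}. Sg n"
  obtain Y where Y: "finite Y" "Y \<subseteq> carrier S" "generated_subalgebra A S Y = carrier S"
    using finitely_generated by blast
  have "\<exists>F. finite F \<and> F \<subseteq> ?D \<and> y \<in> generate_ring S (?K \<union> F)" if "y \<in> Y" for y
  proof -
    have "y \<in> generate_ring S (?K \<union> ?D)"
      using standard Y(2) that unfolding generated_subalgebra_def by blast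
    then show ?thesis by (rule generate_ring_finite_support) blast
  qed
  then obtain F where F: "\<And>y. y \<in> Y \<Longrightarrow> finite (F y)" "\<And>y. y \<in> Y \<Longrightarrow> F y \<subseteq> ?D"
    "\<And>y. y \<in> Y \<Longrightarrow> y \<in> generate_ring S (?K \<union> F y)" by metis
  define X where "X = (\<Union>y\<in>Y. F y)"
  have K: "?K \<subseteq> carrier S" by auto
  have XD: "X \<subseteq> ?D" using F(2) by (auto simp: X_def)
  have Xcar: "X \<subseteq> carrier S" using XD Sg_carrier by blast
  have "finite X" using Y(1) F(1) by (auto simp: X_def)
  have "Y \<subseteq> generate_ring S (?K \<union> X)"
  proof
    fix y assume y: "y \<in> Y"
    have "F y \<subseteq> X" using y by (auto simp: X_def)
    then have "generate_ring S (?K \<union> F y) \<subseteq> generate_ring S (?K \<union> X)"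
      using K Xcar by (intro mono_generate_ring) auto
    then show "y \<in> generate_ring S (?K \<union> X)" using F(3)[OF y] by blast
  qed
  moreover have "?K \<subseteq> generate_ring S (?K \<union> X)" by (auto intro: generate_ring.incl)
  moreover have "subring (generate_ring S (?K \<union> X)) S"
    using K Xcar by (intro generate_ring_is_subring) auto
  ultimately have "generate_ring S (?K \<union> Y) \<subseteq> generate_ring S (?K \<union> X)"
    using K Y(2) by (intro generate_ring_min_subring1) auto
  then have gen: "generated_subalgebra A S X = carrier S"
    using Y(3) generate_ring_incl[of "?K \<union> X"] K Xcar unfolding generated_subalgebra_def by auto
  have "\<exists>i. x \<in> Sg (index_unit i 1)" if "x \<in> X" for x
    using XD that degree_one_index by blast
  then obtain \<delta> where "\<And>x. x \<in> X \<Longrightarrow> x \<in> Sg (index_unit (\<delta> x) 1)" by metis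
  with \<open>finite X\<close> gen that show ?thesis by blast
qed

definition monomial :: "'s set \<Rightarrow> ('s \<Rightarrow> nat) \<Rightarrow> 's" where
  "monomial X a = (\<Otimes>\<^bsub>S\<^esub>x\<in>X. x [^]\<^bsub>S\<^esub> a x)"

lemma monomial_carrier: "X \<subseteq> carrier S \<Longrightarrow> monomial X a \<in> carrier S"
  unfolding monomial_def by (rule finprod_closed) auto

lemma monomial_add:
  assumes "X \<subseteq> carrier S"
  shows "monomial X (a + b) = monomial X a \<otimes>\<^bsub>S\<^esub> monomial X b"
proof -
  have "monomial X (a + b) = (\<Otimes>\<^bsub>S\<^esub>x\<in>X. x [^]\<^bsub>S\<^esub> a x \<otimes>\<^bsub>S\<^esub> x [^]\<^bsub>S\<^esub> b x)"
    unfolding monomial_def using assms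
    by (intro finprod_cong') (auto simp: nat_pow_mult)
  also have "\<dots> = monomial X a \<otimes>\<^bsub>S\<^esub> monomial X b"
    unfolding monomial_def using assms by (intro finprod_multf) auto
  finally show ?thesis .
qed

lemma monomial_zero: "monomial X (\<lambda>_. 0) = \<one>\<^bsub>S\<^esub>"
  unfolding monomial_def by simp

lemma monomial_single:
  assumes "finite X" "X \<subseteq> carrier S" "x \<in> X"
  shows "monomial X (index_unit x 1) = x"
proof -
  have "monomial X (index_unit x 1) = (\<Otimes>\<^bsub>S\<^esub>y\<in>X. if x = y then y else \<one>\<^bsub>S\<^esub>)"
    unfolding monomial_def index_unit_def using assms
    by (intro finprod_cong') (auto simp: nat_pow_eone)
  also have "\<dots> = x" using assms by (intro finprod_singleton) auto
  finally show ?thesis .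
qed

lemma power_degree:
  assumes "x \<in> Sg (index_unit i 1)"
  shows "x [^]\<^bsub>S\<^esub> (k::nat) \<in> Sg (index_unit i k)"
proof (induction k)
  case 0
  have "index_unit i 0 = 0" by (simp add: index_unit_def fun_eq_iff)
  then show ?case by (simp only: nat_pow_0 one_degree_zero)
next
  case (Suc k)
  have "index_unit i k + index_unit i 1 = index_unit i (Suc k)" by (simp add: index_unit_def fun_eq_iff)
  then show ?case using mult_degree[OF Suc assms] by simp
qed

lemma monomial_degree:
  assumes "finite X" "\<And>x. x \<in> X \<Longrightarrow> x \<in> Sg (index_unit (\<delta> x) 1)"
  shows "monomial X a \<in> Sg (multidegree \<delta> X a)"
  using assms
proof (induction X rule: finite_induct)
  case empty
  have "multidegree \<delta> {} a = 0" by (simp add: multidegree_def fun_eq_iff)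
  then show ?case by (simp only: monomial_def finprod_empty one_degree_zero)
next
  case (insert x X)
  have car: "x \<in> carrier S" "X \<subseteq> carrier S" using insert.prems Sg_carrier by auto
  have "monomial (insert x X) a = x [^]\<^bsub>S\<^esub> a x \<otimes>\<^bsub>S\<^esub> monomial X a"
    unfolding monomial_def using insert.hyps car by (intro finprod_insert) auto
  moreover have "multidegree \<delta> (insert x X) a = index_unit (\<delta> x) (a x) + multidegree \<delta> X a"
    by (rule multidegree_insert[OF insert.hyps])
  moreover have "monomial X a \<in> Sg (multidegree \<delta> X a)"
    by (rule insert.IH) (rule insert.prems, simp)
  moreover have "x [^]\<^bsub>S\<^esub> a x \<in> Sg (index_unit (\<delta> x) (a x))"
    by (rule power_degree, rule insert.prems) simp
  ultimately show ?case by (simp only: mult_degree)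
qed

end

section \<open>Graded pieces over the ring of coefficients\<close>

lemma ex1_unique: "\<exists>!x. P x \<Longrightarrow> P a \<Longrightarrow> P b \<Longrightarrow> a = b"
  by blast

locale multigraded_module = alg: standard_multigraded_algebra A S Sg + mod: fg_multigraded_module S Sg M Mg
  for A :: "('a, 'x) ring_scheme"
    and S :: "('a, 's, 'y) module_scheme" and Sg :: "('d::finite \<Rightarrow> nat) \<Rightarrow> 's set"
    and M :: "('s, 'm, 'z) module_scheme" and Mg :: "('d \<Rightarrow> nat) \<Rightarrow> 'm set"
begin

text \<open>
  All graded pieces are submodules of this module over \<open>A\<close>, so that lengths of different pieces are
  lengths of subquotients of one module.
\<close>

abbreviation restricted :: "('a, 'm) module" where
  "restricted \<equiv> graded_piece S M (carrier M)"

lemma restricted_simps [simp]: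
  "carrier restricted = carrier M" "add restricted = add M" "zero restricted = \<zero>\<^bsub>M\<^esub>"
  "a \<odot>\<^bsub>restricted\<^esub> x = (a \<odot>\<^bsub>S\<^esub> \<one>\<^bsub>S\<^esub>) \<odot>\<^bsub>M\<^esub> x"
  by (simp_all add: graded_piece_def)

lemma a_inv_restricted [simp]: "a_inv restricted = a_inv M"
  by (simp add: a_inv_def graded_piece_def fun_eq_iff m_inv_def)

lemma finsum_restricted [simp]: "finsum restricted = finsum M"
  by (simp add: finsum_def finprod_def graded_piece_def fun_eq_iff)

sublocale res: module A restricted
proof (rule moduleI)
  show "abelian_group restricted"
    by (rule abelian_groupI) (auto simp: mod.M.a_ac intro: bexI[of _ "\<ominus>\<^bsub>M\<^esub> x" for x] mod.M.l_neg)
  fix a b x assume ab: "a \<in> carrier A" "b \<in> carrier A" and x: "x \<in> carrier restricted"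
  have one: "\<one>\<^bsub>S\<^esub> \<in> carrier S" by simp
  show "(a \<oplus>\<^bsub>A\<^esub> b) \<odot>\<^bsub>restricted\<^esub> x = a \<odot>\<^bsub>restricted\<^esub> x \<oplus>\<^bsub>restricted\<^esub> b \<odot>\<^bsub>restricted\<^esub> x"
    using ab x by (simp add: alg.smult_l_distr mod.smult_l_distr)
  have "(a \<otimes>\<^bsub>A\<^esub> b) \<odot>\<^bsub>S\<^esub> \<one>\<^bsub>S\<^esub> = (a \<odot>\<^bsub>S\<^esub> \<one>\<^bsub>S\<^esub>) \<otimes>\<^bsub>S\<^esub> (b \<odot>\<^bsub>S\<^esub> \<one>\<^bsub>S\<^esub>)"
    using ab by (simp add: alg.smult_assoc1 alg.smult_assoc2)
  then show "(a \<otimes>\<^bsub>A\<^esub> b) \<odot>\<^bsub>restricted\<^esub> x = a \<odot>\<^bsub>restricted\<^esub> (b \<odot>\<^bsub>restricted\<^esub> x)"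
    using ab x by (simp add: mod.smult_assoc1)
qed (auto simp: alg.R.is_cring mod.smult_r_distr)

lemma Mg_carrier: "x \<in> Mg n \<Longrightarrow> x \<in> carrier M"
  using mod.decomposition unfolding internal_direct_sum_def
  by (metis subgroup.mem_carrier partial_object.select_convs(1))

lemma submodule_Mg: "submodule (Mg n) A restricted"
proof (rule res.submoduleI)
  have sub: "subgroup (Mg n) (add_monoid M)"
    using mod.decomposition by (simp add: internal_direct_sum_def)
  show "Mg n \<subseteq> carrier restricted" using Mg_carrier by auto
  show "\<zero>\<^bsub>restricted\<^esub> \<in> Mg n" using subgroup.one_closed[OF sub] by simp
  show "\<And>x. x \<in> Mg n \<Longrightarrow> \<ominus>\<^bsub>restricted\<^esub> x \<in> Mg n"
    unfolding a_inv_restricted by (simp only: a_inv_def subgroup.m_inv_closed[OF sub])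
  show "\<And>x y. x \<in> Mg n \<Longrightarrow> y \<in> Mg n \<Longrightarrow> x \<oplus>\<^bsub>restricted\<^esub> y \<in> Mg n"
    using subgroup.m_closed[OF sub] by simp
  show "\<And>a x. a \<in> carrier A \<Longrightarrow> x \<in> Mg n \<Longrightarrow> a \<odot>\<^bsub>restricted\<^esub> x \<in> Mg n"
    using mod.smult_degree[OF alg.scalars_degree_zero] by simp
qed

lemma submodule_graded_piece_iff:
  "submodule C A (graded_piece S M (Mg n)) \<longleftrightarrow> submodule C A restricted \<and> C \<subseteq> Mg n"
proof -
  let ?P = "graded_piece S M (Mg n)"
  have P: "?P = restricted\<lparr>carrier := Mg n\<rparr>" by (simp add: graded_piece_def)
  interpret P: module A ?P
    unfolding P by (rule submodule.submodule_is_module[OF submodule_Mg res.module_axioms])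
  have simps: "carrier ?P = Mg n" "add ?P = add M" "zero ?P = \<zero>\<^bsub>M\<^esub>"
    "\<And>a x. a \<odot>\<^bsub>?P\<^esub> x = (a \<odot>\<^bsub>S\<^esub> \<one>\<^bsub>S\<^esub>) \<odot>\<^bsub>M\<^esub> x"
    by (simp_all add: graded_piece_def)
  have inv: "\<ominus>\<^bsub>?P\<^esub> x = \<ominus>\<^bsub>M\<^esub> x" if "x \<in> Mg n" for x
  proof (rule P.M.minus_equality)
    show "\<ominus>\<^bsub>M\<^esub> x \<oplus>\<^bsub>?P\<^esub> x = \<zero>\<^bsub>?P\<^esub>"
      using Mg_carrier[OF that] by (simp add: simps mod.M.l_neg)
    show "x \<in> carrier ?P" "\<ominus>\<^bsub>M\<^esub> x \<in> carrier ?P"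
      using that res.submoduleE(3)[OF submodule_Mg that] by (simp_all add: simps)
  qed
  show ?thesis
  proof
    assume C: "submodule C A ?P"
    have sub: "C \<subseteq> Mg n" using P.submoduleE(1)[OF C] by (simp add: simps)
    moreover have "submodule C A restricted"
      by (rule res.submoduleI)
        (use sub Mg_carrier P.submoduleE(3-5)[OF C] P.submodule_zero_mem[OF C] inv
          in \<open>auto simp: simps subset_iff\<close>)
    ultimately show "submodule C A restricted \<and> C \<subseteq> Mg n" by blast
  next
    assume C: "submodule C A restricted \<and> C \<subseteq> Mg n"
    show "submodule C A ?P"
      by (rule P.submoduleI)
        (use C res.submoduleE(3-5)[OF conjunct1[OF C]] res.submodule_zero_mem[OF conjunct1[OF C]] inv
          in \<open>auto simp: simps subset_iff\<close>)
  qed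
qed

text \<open>
  Every submodule contains zero, so the chains of submodules of a graded piece are the chains between
  zero and that piece.
\<close>

lemma module_length_graded_piece:
  assumes fin: "finite_length A restricted {\<zero>\<^bsub>M\<^esub>} (Mg n)"
  shows "module_length A (graded_piece S M (Mg n)) = enat (quotient_length A restricted {\<zero>\<^bsub>M\<^esub>} (Mg n))"
proof -
  have zero: "{\<zero>\<^bsub>M\<^esub>} \<subseteq> C" if "submodule C A restricted" for C
    using res.submodule_zero_subset[OF that] by simp
  have "(\<exists>C. (\<forall>i\<le>l. submodule (C i) A (graded_piece S M (Mg n))) \<and> (\<forall>i<l. C i \<subset> C (Suc i)))
      \<longleftrightarrow> has_chain A restricted {\<zero>\<^bsub>M\<^esub>} (Mg n) l" for l
    unfolding has_chain_def submodule_graded_piece_iff using zero by (intro arg_cong[where f = Ex] ext) blast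
  then have len: "module_length A (graded_piece S M (Mg n)) =
      (SUP l\<in>{l. has_chain A restricted {\<zero>\<^bsub>M\<^esub>} (Mg n) l}. enat l)"
    by (simp add: module_length_def)
  have "has_chain A restricted {\<zero>\<^bsub>M\<^esub>} (Mg n) (quotient_length A restricted {\<zero>\<^bsub>M\<^esub>} (Mg n))"
    using has_chain_quotient_length[OF fin] res.submodule_zero zero[OF submodule_Mg] by simp
  then show ?thesis
    unfolding len using has_chain_le_quotient_length[OF fin]
    by (intro antisym SUP_least SUP_upper) auto
qed

text \<open>
  The homogeneous components of a finite generating set.
\<close>

lemma finite_homogeneous_generators:
  obtains G \<gamma> where "finite G" "\<And>g. g \<in> G \<Longrightarrow> g \<in> Mg (\<gamma> g)"
    "\<And>H. submodule H S M \<Longrightarrow> G \<subseteq> H \<Longrightarrow> H = carrier M"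
proof -
  obtain Y where Y: "finite Y" "Y \<subseteq> carrier M" "(\<lambda>H. submodule H S M) hull Y = carrier M"
    using mod.finitely_generated by blast
  have "\<exists>c. (\<forall>n. c n \<in> Mg n) \<and> finite {n. c n \<noteq> \<zero>\<^bsub>M\<^esub>} \<and> y = (\<Oplus>\<^bsub>M\<^esub>n\<in>{n. c n \<noteq> \<zero>\<^bsub>M\<^esub>}. c n)"
    if "y \<in> Y" for y
  proof (rule ex1_implies_ex)
    have "y \<in> carrier M" using Y(2) that by blast
    with mod.decomposition show "\<exists>!c. (\<forall>n. c n \<in> Mg n) \<and> finite {n. c n \<noteq> \<zero>\<^bsub>M\<^esub>} \<and>
        y = (\<Oplus>\<^bsub>M\<^esub>n\<in>{n. c n \<noteq> \<zero>\<^bsub>M\<^esub>}. c n)"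
      unfolding internal_direct_sum_def by (elim conjE) (erule bspec)
  qed
  then have "\<forall>y\<in>Y. \<exists>c. (\<forall>n. c n \<in> Mg n) \<and> finite {n. c n \<noteq> \<zero>\<^bsub>M\<^esub>} \<and>
      y = (\<Oplus>\<^bsub>M\<^esub>n\<in>{n. c n \<noteq> \<zero>\<^bsub>M\<^esub>}. c n)" by simp
  from bchoice[OF this] obtain c where "\<forall>y\<in>Y. (\<forall>n. c y n \<in> Mg n) \<and> finite {n. c y n \<noteq> \<zero>\<^bsub>M\<^esub>} \<and>
      y = (\<Oplus>\<^bsub>M\<^esub>n\<in>{n. c y n \<noteq> \<zero>\<^bsub>M\<^esub>}. c y n)" ..
  then have c: "\<And>y n. y \<in> Y \<Longrightarrow> c y n \<in> Mg n" "\<And>y. y \<in> Y \<Longrightarrow> finite {n. c y n \<noteq> \<zero>\<^bsub>M\<^esub>}"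
    "\<And>y. y \<in> Y \<Longrightarrow> y = (\<Oplus>\<^bsub>M\<^esub>n\<in>{n. c y n \<noteq> \<zero>\<^bsub>M\<^esub>}. c y n)" by simp_all
  define G where "G = (\<Union>y\<in>Y. c y ` {n. c y n \<noteq> \<zero>\<^bsub>M\<^esub>})"
  have "finite G" using Y(1) c(2) by (auto simp: G_def)
  moreover have "\<exists>n. g \<in> Mg n" if "g \<in> G" for g using that c(1) by (auto simp: G_def)
  then obtain \<gamma> where "\<And>g. g \<in> G \<Longrightarrow> g \<in> Mg (\<gamma> g)" by metis
  moreover have "H = carrier M" if H: "submodule H S M" "G \<subseteq> H" for H
  proof -
    have sum: "(\<Oplus>\<^bsub>M\<^esub>n\<in>F. f n) \<in> H" if "finite F" "\<And>n. n \<in> F \<Longrightarrow> f n \<in> H" for F and f :: "('d \<Rightarrow> nat) \<Rightarrow> 'm"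
      using that
    proof (induction F rule: finite_induct)
      case empty
      then show ?case using mod.submodule_zero_mem[OF H(1)] by simp
    next
      case (insert n F)
      have "f \<in> F \<rightarrow> carrier M" "f n \<in> carrier M" using insert.prems mod.submoduleE(1)[OF H(1)] by auto
      then have "(\<Oplus>\<^bsub>M\<^esub>n\<in>insert n F. f n) = f n \<oplus>\<^bsub>M\<^esub> (\<Oplus>\<^bsub>M\<^esub>n\<in>F. f n)"
        using insert.hyps by (intro mod.M.finsum_insert)
      then show ?case using mod.submoduleE(5)[OF H(1)] insert by simp
    qed
    have "Y \<subseteq> H"
    proof
      fix y assume y: "y \<in> Y"
      have "(\<Oplus>\<^bsub>M\<^esub>n\<in>{n. c y n \<noteq> \<zero>\<^bsub>M\<^esub>}. c y n) \<in> H"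
        by (rule sum[OF c(2)[OF y]]) (use H(2) y in \<open>auto simp: G_def\<close>)
      then show "y \<in> H" using c(3)[OF y] by simp
    qed
    then have "carrier M \<subseteq> H" using hull_minimal[of Y H "\<lambda>H. submodule H S M"] H(1) Y(3) by simp
    then show ?thesis using mod.submoduleE(1)[OF H(1)] by blast
  qed
  ultimately show ?thesis using that by blast
qed

text \<open>
  The set \<open>T\<close> of all finite sums of elements of the spans of the \<open>B n\<close> is a submodule that contains
  the generators, so it is everything. An element of \<open>Mg n\<close>, written as such a sum, has no
  components in other degrees because homogeneous decompositions are unique.
\<close>

lemma Mg_eq_span:
  assumes B: "\<And>n. B n \<subseteq> Mg n" and gen: "res.submodule_span (\<Union>n. B n) = carrier M"
  shows "Mg n = res.submodule_span (B n)"
proof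
  have Bcar: "B n \<subseteq> carrier restricted" for n using B Mg_carrier by auto
  note span = res.submodule_submodule_span[OF Bcar]
  have span_Mg: "res.submodule_span (B n) \<subseteq> Mg n" for n
    by (rule res.submodule_span_minimal[OF B submodule_Mg])
  then show "res.submodule_span (B n) \<subseteq> Mg n" .
  have span_car: "x \<in> carrier M" if "x \<in> res.submodule_span (B n)" for x n
    using span_Mg Mg_carrier that by blast
  define T where "T = {x. \<exists>F c. finite F \<and> (\<forall>n. c n \<in> res.submodule_span (B n)) \<and>
    (\<forall>n. n \<notin> F \<longrightarrow> c n = \<zero>\<^bsub>M\<^esub>) \<and> x = (\<Oplus>\<^bsub>M\<^esub>n\<in>F. c n)}"
  have enlarge: "(\<Oplus>\<^bsub>M\<^esub>n\<in>F. c n) = (\<Oplus>\<^bsub>M\<^esub>n\<in>F'. c n)"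
    if "finite F'" "F \<subseteq> F'" "\<forall>n. n \<notin> F \<longrightarrow> c n = \<zero>\<^bsub>M\<^esub>" "\<forall>n. c n \<in> carrier M" for c and F F' :: "('d \<Rightarrow> nat) set"
    using that by (intro mod.M.add.finprod_mono_neutral_cong_left) auto
  have TI: "(\<Oplus>\<^bsub>M\<^esub>n\<in>F. c n) \<in> T" if "finite F" "\<forall>n. c n \<in> res.submodule_span (B n)" "\<forall>n. n \<notin> F \<longrightarrow> c n = \<zero>\<^bsub>M\<^esub>" for F c
    using that unfolding T_def by blast
  have "submodule T A restricted"
  proof (rule res.submoduleI)
    show "T \<subseteq> carrier restricted" using span_car by (auto simp: T_def intro!: mod.M.finsum_closed)
    show "\<zero>\<^bsub>restricted\<^esub> \<in> T"
      using TI[of "{}" "\<lambda>_. \<zero>\<^bsub>M\<^esub>"] res.submodule_zero_mem[OF span] by simp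
    have smult: "s \<odot>\<^bsub>restricted\<^esub> x \<in> T" if s: "s \<in> carrier A" and x: "x \<in> T" for s x
    proof -
      obtain F c where c: "finite F" "\<forall>n. c n \<in> res.submodule_span (B n)"
        "\<forall>n. n \<notin> F \<longrightarrow> c n = \<zero>\<^bsub>M\<^esub>" "x = (\<Oplus>\<^bsub>M\<^esub>n\<in>F. c n)"
        using x by (auto simp: T_def)
      have "s \<odot>\<^bsub>restricted\<^esub> x = (\<Oplus>\<^bsub>M\<^esub>n\<in>F. s \<odot>\<^bsub>restricted\<^esub> c n)"
        using res.finsum_smult_ldistr[OF c(1) s, of c] c(2) span_car by (auto simp: c(4))
      moreover have "\<forall>n. s \<odot>\<^bsub>restricted\<^esub> c n \<in> res.submodule_span (B n)"
        using res.submoduleE(4)[OF span s] c(2) by blast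
      moreover have "\<forall>n. n \<notin> F \<longrightarrow> s \<odot>\<^bsub>restricted\<^esub> c n = \<zero>\<^bsub>M\<^esub>" using c(3) s by simp
      ultimately show ?thesis using TI[OF c(1), of "\<lambda>n. s \<odot>\<^bsub>restricted\<^esub> c n"] by simp
    qed
    then show "\<And>a x. a \<in> carrier A \<Longrightarrow> x \<in> T \<Longrightarrow> a \<odot>\<^bsub>restricted\<^esub> x \<in> T" .
    fix x assume x: "x \<in> T"
    have xcar: "x \<in> carrier restricted" using x span_car by (auto simp: T_def intro!: mod.M.finsum_closed)
    have "\<ominus>\<^bsub>restricted\<^esub> x = (\<ominus>\<^bsub>A\<^esub> \<one>\<^bsub>A\<^esub>) \<odot>\<^bsub>restricted\<^esub> x"
      using res.smult_l_minus[OF alg.R.one_closed xcar] res.smult_one[OF xcar] by (simp only:)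
    then show "\<ominus>\<^bsub>restricted\<^esub> x \<in> T" using smult[OF _ x, of "\<ominus>\<^bsub>A\<^esub> \<one>\<^bsub>A\<^esub>"] by simp
    fix y assume y: "y \<in> T"
    obtain F c where c: "finite F" "\<forall>n. c n \<in> res.submodule_span (B n)"
      "\<forall>n. n \<notin> F \<longrightarrow> c n = \<zero>\<^bsub>M\<^esub>" "x = (\<Oplus>\<^bsub>M\<^esub>n\<in>F. c n)"
      using x by (auto simp: T_def)
    obtain F' c' where c': "finite F'" "\<forall>n. c' n \<in> res.submodule_span (B n)"
      "\<forall>n. n \<notin> F' \<longrightarrow> c' n = \<zero>\<^bsub>M\<^esub>" "y = (\<Oplus>\<^bsub>M\<^esub>n\<in>F'. c' n)"
      using y by (auto simp: T_def)
    have car: "\<forall>n. c n \<in> carrier M" "\<forall>n. c' n \<in> carrier M" using c(2) c'(2) span_car by blast+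
    have "x \<oplus>\<^bsub>M\<^esub> y = (\<Oplus>\<^bsub>M\<^esub>n\<in>F \<union> F'. c n) \<oplus>\<^bsub>M\<^esub> (\<Oplus>\<^bsub>M\<^esub>n\<in>F \<union> F'. c' n)"
      using enlarge[of "F \<union> F'" F c] enlarge[of "F \<union> F'" F' c'] c(1,3) c'(1,3) car
      by (simp add: c(4) c'(4))
    also have "\<dots> = (\<Oplus>\<^bsub>M\<^esub>n\<in>F \<union> F'. c n \<oplus>\<^bsub>M\<^esub> c' n)"
      by (rule mod.M.finsum_addf[symmetric]) (use car in auto)
    finally have "x \<oplus>\<^bsub>M\<^esub> y = (\<Oplus>\<^bsub>M\<^esub>n\<in>F \<union> F'. c n \<oplus>\<^bsub>M\<^esub> c' n)" .
    moreover have "\<forall>n. c n \<oplus>\<^bsub>M\<^esub> c' n \<in> res.submodule_span (B n)"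
      using res.submoduleE(5)[OF span] c(2) c'(2) by simp
    ultimately show "x \<oplus>\<^bsub>restricted\<^esub> y \<in> T"
      using TI[of "F \<union> F'" "\<lambda>n. c n \<oplus>\<^bsub>M\<^esub> c' n"] c(1,3) c'(1,3) by simp
  qed
  moreover have "(\<Union>n. B n) \<subseteq> T"
  proof
    fix b assume "b \<in> (\<Union>n. B n)"
    then obtain n where n: "b \<in> B n" by blast
    have bcar: "b \<in> carrier M" using Bcar n by auto
    have "(\<Oplus>\<^bsub>M\<^esub>m\<in>{n}. (if m = n then b else \<zero>\<^bsub>M\<^esub>)) = b"
      using bcar by (subst mod.M.finsum_insert) auto
    moreover have "(\<Oplus>\<^bsub>M\<^esub>m\<in>{n}. (if m = n then b else \<zero>\<^bsub>M\<^esub>)) \<in> T"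
      by (rule TI) (use n res.submodule_span_superset res.submodule_zero_mem[OF span] in auto)
    ultimately show "b \<in> T" by simp
  qed
  ultimately have T: "carrier M \<subseteq> T" using res.submodule_span_minimal gen by metis
  show "Mg n \<subseteq> res.submodule_span (B n)"
  proof
    fix x assume x: "x \<in> Mg n"
    have xcar: "x \<in> carrier M" using x by (rule Mg_carrier)
    then obtain F c where c: "finite F" "\<forall>n. c n \<in> res.submodule_span (B n)"
      "\<forall>n. n \<notin> F \<longrightarrow> c n = \<zero>\<^bsub>M\<^esub>" "x = (\<Oplus>\<^bsub>M\<^esub>n\<in>F. c n)"
      using T by (auto simp: T_def)
    let ?dec = "\<lambda>c. (\<forall>n. c n \<in> Mg n) \<and> finite {n. c n \<noteq> \<zero>\<^bsub>M\<^esub>} \<and> x = (\<Oplus>\<^bsub>M\<^esub>n\<in>{n. c n \<noteq> \<zero>\<^bsub>M\<^esub>}. c n)"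
    have supp: "{n. c n \<noteq> \<zero>\<^bsub>M\<^esub>} \<subseteq> F" using c(3) by blast
    have "(\<Oplus>\<^bsub>M\<^esub>n\<in>{n. c n \<noteq> \<zero>\<^bsub>M\<^esub>}. c n) = (\<Oplus>\<^bsub>M\<^esub>n\<in>F. c n)"
      by (rule enlarge[OF c(1) supp]) (use c(2) span_car in auto)
    then have dec1: "?dec c" using c span_Mg finite_subset[OF supp c(1)] by auto
    have dec2: "?dec (\<lambda>m. if m = n then x else \<zero>\<^bsub>M\<^esub>)"
    proof -
      let ?c = "\<lambda>m. if m = n then x else \<zero>\<^bsub>M\<^esub>"
      have sub: "{m. ?c m \<noteq> \<zero>\<^bsub>M\<^esub>} \<subseteq> {n}" by auto
      have "(\<Oplus>\<^bsub>M\<^esub>m\<in>{m. ?c m \<noteq> \<zero>\<^bsub>M\<^esub>}. ?c m) = (\<Oplus>\<^bsub>M\<^esub>m\<in>{n}. ?c m)"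
        by (rule enlarge) (use xcar in auto)
      also have "\<dots> = x" using xcar by (subst mod.M.finsum_insert) auto
      finally have "x = (\<Oplus>\<^bsub>M\<^esub>m\<in>{m. ?c m \<noteq> \<zero>\<^bsub>M\<^esub>}. ?c m)" by (rule sym)
      moreover have "\<forall>m. ?c m \<in> Mg m" using x res.submodule_zero_mem[OF submodule_Mg] by auto
      ultimately show ?thesis using finite_subset[OF sub] by auto
    qed
    have dec: "\<exists>!c. ?dec c"
      using mod.decomposition xcar unfolding internal_direct_sum_def by (elim conjE) (erule bspec)
    have "c = (\<lambda>m. if m = n then x else \<zero>\<^bsub>M\<^esub>)"
      by (rule ex1_unique[where P = ?dec and a = c, OF dec dec1 dec2])
    then have "c n = x" by simp
    then show "x \<in> res.submodule_span (B n)" using c(2) by auto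
  qed
qed

end

section \<open>The Hilbert function\<close>

text \<open>
  A monomial order: assigning distinct primes to the variables embeds the monoid of exponents into the
  positive integers with multiplication, by unique factorisation, and multiplication by a positive
  integer preserves the usual order.
\<close>

lemma multiplicative_monomial_weight:
  assumes "finite X"
  obtains w :: "('x \<Rightarrow> nat) \<Rightarrow> nat" where "\<And>a b. w (a + b) = w a * w b" "\<And>a. 0 < w a"
    "inj_on w (exponents X)"
proof -
  obtain B :: "nat set" where B: "finite B" "card B = card X" "B \<subseteq> {p. prime p}"
    using infinite_arbitrarily_large[OF primes_infinite] by blast
  then obtain p where p: "p ` X \<subseteq> B" "inj_on p X"
    using card_le_inj[OF assms B(1)] by auto
  then have prime: "prime (p x)" if "x \<in> X" for x using B(3) that by blast
  define w where "w a = (\<Prod>x\<in>X. p x ^ a x)" for a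
  have mult: "multiplicity (p x) (w a) = a x" if x: "x \<in> X" for x a
  proof -
    have "w a = (\<Prod>q\<in>p ` X. q ^ a (inv_into X p q))"
      unfolding w_def using p(2) by (subst prod.reindex) (auto intro!: prod.cong)
    moreover have "multiplicity (p x) (\<Prod>q\<in>p ` X. q ^ a (inv_into X p q)) =
        (if p x \<in> p ` X then a (inv_into X p (p x)) else 0)"
      using prime assms x by (intro multiplicity_prod_prime_powers) auto
    ultimately show ?thesis using x p(2) by simp
  qed
  have "inj_on w (exponents X)"
  proof (rule inj_onI)
    fix a b assume ab: "a \<in> exponents X" "b \<in> exponents X" "w a = w b"
    have "a x = b x" for x
      using mult[of x a] mult[of x b] ab by (cases "x \<in> X") (auto simp: exponents_def)
    then show "a = b" by blast
  qed
  moreover have "w (a + b) = w a * w b" for a b by (simp add: w_def power_add prod.distrib)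
  moreover have "0 < w a" for a using prime by (auto simp: w_def prime_gt_0_nat intro!: prod_pos)
  ultimately show ?thesis using that by blast
qed

context multigraded_module
begin

text \<open>
  The span over \<open>A\<close> is stable under the variables, hence under the subring that the variables and the
  scalars generate, which is all of \<open>S\<close>.
\<close>

lemma monomials_times_generators_span:
  assumes X: "finite X" "X \<subseteq> carrier S" "generated_subalgebra A S X = carrier S"
    and G: "G \<subseteq> carrier M" "\<And>H. submodule H S M \<Longrightarrow> G \<subseteq> H \<Longrightarrow> H = carrier M"
  shows "res.submodule_span {alg.monomial X a \<odot>\<^bsub>M\<^esub> g |a g. a \<in> exponents X \<and> g \<in> G} = carrier M"
proof -
  let ?V = "{alg.monomial X a \<odot>\<^bsub>M\<^esub> g |a g. a \<in> exponents X \<and> g \<in> G}"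
  let ?W = "res.submodule_span ?V"
  note mon = alg.monomial_carrier[OF X(2)]
  have V: "?V \<subseteq> carrier restricted" using mon G(1) by auto
  note W = res.submodule_submodule_span[OF V]
  have Wcar: "x \<in> carrier M" if "x \<in> ?W" for x using res.submoduleE(1)[OF W] that by auto
  have gen: "x \<odot>\<^bsub>M\<^esub> m \<in> ?W" if x: "x \<in> X" and m: "m \<in> ?W" for x m
  proof -
    have xcar: "x \<in> carrier S" using x X(2) by blast
    let ?T = "{m \<in> carrier M. x \<odot>\<^bsub>M\<^esub> m \<in> ?W}"
    have "submodule ?T A restricted"
    proof (rule res.submoduleI)
      show "?T \<subseteq> carrier restricted" by auto
      show "\<zero>\<^bsub>restricted\<^esub> \<in> ?T" using res.submodule_zero_mem[OF W] xcar by simp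
      show "\<And>y. y \<in> ?T \<Longrightarrow> \<ominus>\<^bsub>restricted\<^esub> y \<in> ?T"
        using res.submoduleE(3)[OF W] xcar by (simp add: mod.smult_r_minus)
      show "\<And>y z. y \<in> ?T \<Longrightarrow> z \<in> ?T \<Longrightarrow> y \<oplus>\<^bsub>restricted\<^esub> z \<in> ?T"
        using res.submoduleE(5)[OF W] xcar by (simp add: mod.smult_r_distr)
      fix a y assume a: "a \<in> carrier A" and y: "y \<in> ?T"
      have "x \<odot>\<^bsub>M\<^esub> ((a \<odot>\<^bsub>S\<^esub> \<one>\<^bsub>S\<^esub>) \<odot>\<^bsub>M\<^esub> y) = (a \<odot>\<^bsub>S\<^esub> \<one>\<^bsub>S\<^esub>) \<odot>\<^bsub>M\<^esub> (x \<odot>\<^bsub>M\<^esub> y)"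
        using a y xcar by (simp add: mod.smult_assoc1[symmetric] alg.m_comm)
      then show "a \<odot>\<^bsub>restricted\<^esub> y \<in> ?T"
        using res.submoduleE(4)[OF W a, of "x \<odot>\<^bsub>M\<^esub> y"] a y by simp
    qed
    moreover have "?V \<subseteq> ?T"
    proof
      fix y assume "y \<in> ?V"
      then obtain a g where ag: "a \<in> exponents X" "g \<in> G" "y = alg.monomial X a \<odot>\<^bsub>M\<^esub> g" by blast
      have gcar: "g \<in> carrier M" using ag(2) G(1) by blast
      have "alg.monomial X (index_unit x 1 + a) = x \<otimes>\<^bsub>S\<^esub> alg.monomial X a"
        by (simp only: alg.monomial_add[OF X(2)] alg.monomial_single[OF X(1,2) x])
      then have "x \<odot>\<^bsub>M\<^esub> y = alg.monomial X (index_unit x 1 + a) \<odot>\<^bsub>M\<^esub> g"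
        using xcar gcar mon by (simp add: ag(3) mod.smult_assoc1)
      moreover have "index_unit x 1 + a \<in> exponents X"
        using ag(1) x by (auto simp: exponents_def index_unit_def)
      ultimately have "x \<odot>\<^bsub>M\<^esub> y \<in> ?V" using ag(2) by blast
      then have "x \<odot>\<^bsub>M\<^esub> y \<in> ?W" using res.submodule_span_superset[of ?V] by blast
      moreover have "y \<in> carrier M" using ag(3) gcar mon by simp
      ultimately show "y \<in> ?T" by simp
    qed
    ultimately have "?W \<subseteq> ?T" by (rule res.submodule_span_minimal[rotated])
    with m show ?thesis by blast
  qed
  have closed: "s \<odot>\<^bsub>M\<^esub> m \<in> ?W" if s: "s \<in> carrier S" and m: "m \<in> ?W" for s m
  proof -
    have "s \<in> generate_ring S ((\<lambda>a. a \<odot>\<^bsub>S\<^esub> \<one>\<^bsub>S\<^esub>) ` carrier A \<union> X)"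
      using s X(3) by (simp add: generated_subalgebra_def)
    then have "s \<in> carrier S \<and> (\<forall>m\<in>?W. s \<odot>\<^bsub>M\<^esub> m \<in> ?W)"
    proof induction
      case one
      then show ?case using Wcar by simp
    next
      case (incl h)
      then show ?case
      proof
        assume "h \<in> X"
        then show ?thesis using gen X(2) by blast
      next
        assume "h \<in> (\<lambda>a. a \<odot>\<^bsub>S\<^esub> \<one>\<^bsub>S\<^esub>) ` carrier A"
        then obtain a where a: "a \<in> carrier A" "h = a \<odot>\<^bsub>S\<^esub> \<one>\<^bsub>S\<^esub>" by blast
        have "h \<odot>\<^bsub>M\<^esub> m \<in> ?W" if "m \<in> ?W" for m
          using res.submoduleE(4)[OF W a(1) that] by (simp add: a(2))
        then show ?thesis using a by simp
      qed
    next
      case (a_inv h)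
      have "(\<ominus>\<^bsub>S\<^esub> h) \<odot>\<^bsub>M\<^esub> m \<in> ?W" if "m \<in> ?W" for m
      proof -
        have "(\<ominus>\<^bsub>S\<^esub> h) \<odot>\<^bsub>M\<^esub> m = \<ominus>\<^bsub>M\<^esub> (h \<odot>\<^bsub>M\<^esub> m)"
          using a_inv.IH Wcar[OF that] by (simp add: mod.smult_l_minus)
        then show ?thesis using res.submoduleE(3)[OF W, of "h \<odot>\<^bsub>M\<^esub> m"] a_inv.IH that by simp
      qed
      then show ?case using a_inv.IH by simp
    next
      case (eng_add h1 h2)
      have "(h1 \<oplus>\<^bsub>S\<^esub> h2) \<odot>\<^bsub>M\<^esub> m \<in> ?W" if "m \<in> ?W" for m
      proof -
        have "(h1 \<oplus>\<^bsub>S\<^esub> h2) \<odot>\<^bsub>M\<^esub> m = h1 \<odot>\<^bsub>M\<^esub> m \<oplus>\<^bsub>M\<^esub> h2 \<odot>\<^bsub>M\<^esub> m"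
          using eng_add.IH Wcar[OF that] by (simp add: mod.smult_l_distr)
        then show ?thesis
          using res.submoduleE(5)[OF W, of "h1 \<odot>\<^bsub>M\<^esub> m" "h2 \<odot>\<^bsub>M\<^esub> m"] eng_add.IH that by simp
      qed
      then show ?case using eng_add.IH by simp
    next
      case (eng_mult h1 h2)
      have "(h1 \<otimes>\<^bsub>S\<^esub> h2) \<odot>\<^bsub>M\<^esub> m \<in> ?W" if "m \<in> ?W" for m
        using eng_mult.IH Wcar[OF that] that by (simp add: mod.smult_assoc1)
      then show ?case using eng_mult.IH by simp
    qed
    with m show ?thesis by blast
  qed
  have "submodule ?W S M"
  proof (rule mod.submoduleI)
    show "?W \<subseteq> carrier M" using Wcar by blast
  qed (use closed res.submoduleE(3,5)[OF W] res.submodule_zero_mem[OF W] in auto)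
  moreover have "G \<subseteq> ?W"
  proof
    fix g assume g: "g \<in> G"
    have "g = alg.monomial X (\<lambda>_. 0) \<odot>\<^bsub>M\<^esub> g" using g G(1) by (auto simp: alg.monomial_zero)
    moreover have "(\<lambda>_. 0) \<in> exponents X" by (simp add: exponents_def)
    ultimately have "g \<in> ?V" using g by blast
    then show "g \<in> ?W" using res.submodule_span_superset[of ?V] by blast
  qed
  ultimately show ?thesis by (rule G(2))
qed

text \<open>
  The length of \<open>M\<^sub>n\<close> is split along the products \<open>v (a, g)\<close> of a monomial and a generator that have
  degree \<open>n\<close>, ordered by the weight of the monomial and then by the index of the generator.
\<close>

theorem positive_hilbert_type_length:
  assumes finite_A: "finite_length A (ring_module A) {\<zero>\<^bsub>A\<^esub>} (carrier A)"
  obtains f where "positive_hilbert_type f"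
    "\<And>n. module_length A (graded_piece S M (Mg n)) = enat (f n)"
proof -
  obtain X \<delta> where X: "finite X" "\<And>x. x \<in> X \<Longrightarrow> x \<in> Sg (index_unit (\<delta> x) 1)"
    "generated_subalgebra A S X = carrier S"
    using alg.finite_degree_one_generators by blast
  have Xcar: "X \<subseteq> carrier S" using X(2) alg.Sg_carrier by blast
  obtain G \<gamma> where G: "finite G" "\<And>g. g \<in> G \<Longrightarrow> g \<in> Mg (\<gamma> g)"
    "\<And>H. submodule H S M \<Longrightarrow> G \<subseteq> H \<Longrightarrow> H = carrier M"
    using finite_homogeneous_generators by blast
  have Gcar: "G \<subseteq> carrier M" using G(2) Mg_carrier by blast
  obtain w :: "('s \<Rightarrow> nat) \<Rightarrow> nat" where w: "\<And>a b. w (a + b) = w a * w b" "\<And>a. 0 < w a"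
    "inj_on w (exponents X)"
    using multiplicative_monomial_weight[OF X(1)] by blast
  obtain idx :: "'m \<Rightarrow> nat" where idx: "inj_on idx G"
    using finite_imp_inj_to_nat_seg[OF G(1)] by blast
  note mon = alg.monomial_carrier[OF Xcar]
  define v where "v = (\<lambda>(a, g). alg.monomial X a \<odot>\<^bsub>M\<^esub> g)"
  define key where "key = (\<lambda>(a, g). (w a, idx g))"
  define J where "J n = {(a, g). a \<in> exponents X \<and> g \<in> G \<and> multidegree \<delta> X a + \<gamma> g = n}" for n
  define below where "below n b = {c \<in> J n. key c < key b}" for n b
  define upto where "upto n b = {c \<in> J n. key c \<le> key b}" for n b
  define len where "len n b = quotient_length A restricted
    (res.submodule_span (v ` below n b)) (res.submodule_span (v ` upto n b))" for n b
  have v_Mg: "v ` J n \<subseteq> Mg n" for n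
  proof
    fix y assume "y \<in> v ` J n"
    then obtain a g where "a \<in> exponents X" "g \<in> G" "multidegree \<delta> X a + \<gamma> g = n"
      "y = alg.monomial X a \<odot>\<^bsub>M\<^esub> g" by (auto simp: J_def v_def)
    then show "y \<in> Mg n"
      using mod.smult_degree[OF alg.monomial_degree[OF X(1,2)] G(2)] by blast
  qed
  then have v_car: "v ` J n \<subseteq> carrier restricted" for n using Mg_carrier by auto
  have "(\<Union>n. v ` J n) = {alg.monomial X a \<odot>\<^bsub>M\<^esub> g |a g. a \<in> exponents X \<and> g \<in> G}"
    by (auto simp: J_def v_def)
  then have Mg: "Mg n = res.submodule_span (v ` J n)" for n
    using monomials_times_generators_span[OF X(1) Xcar X(3) Gcar G(3)]
    by (intro Mg_eq_span[of "\<lambda>n. v ` J n"] v_Mg) simp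
  have finJ: "finite (J n)" for n
  proof (rule finite_subset)
    show "J n \<subseteq> (\<Union>g\<in>G. {a \<in> exponents X. multidegree \<delta> X a = n - \<gamma> g} \<times> {g})"
      by (auto simp: J_def)
    show "finite (\<Union>g\<in>G. {a \<in> exponents X. multidegree \<delta> X a = n - \<gamma> g} \<times> {g})"
      using G(1) finite_exponents_of_degree[OF X(1)] by auto
  qed
  have inj: "inj_on key (J n)" for n
    using w(3) idx by (auto simp: inj_on_def key_def J_def)
  have upto_insert: "upto n b = insert b (below n b)" if "b \<in> J n" for n b
    using inj[of n] that by (auto simp: upto_def below_def order_le_less inj_on_def)
  have below_car: "v ` below n b \<subseteq> carrier restricted" for n b
    using v_car[of n] by (auto simp: below_def)
  have span_upto: "res.submodule_span (v ` upto n b) =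
      res.submodule_sum (res.submodule_span (v ` below n b)) (res.multiples (v b))" if "b \<in> J n" for n b
    unfolding upto_insert[OF that] image_insert
    by (rule res.submodule_span_insert[OF below_car]) (use v_car that in blast)
  have fin: "finite_length A restricted (res.submodule_span (v ` below n b)) (res.submodule_span (v ` upto n b))"
    if b: "b \<in> J n" for n b
  proof -
    interpret ring: module A "ring_module A" by (rule alg.R.module_ring_module)
    have vb: "v b \<in> carrier restricted" using v_car b by blast
    have one: "\<one>\<^bsub>A\<^esub> \<in> carrier (ring_module A)" by simp
    have "submodule (ring.submodule_sum {\<zero>\<^bsub>A\<^esub>} (ring.multiples \<one>\<^bsub>A\<^esub>)) A (ring_module A)"
      using ring.submodule_zero by (intro ring.submodule_submodule_sum ring.submodule_multiples one) simp
    from ring.submoduleE(1)[OF this]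
    \<comment> \<open>The element \<open>v b\<close> is the image of 1 under \<open>a \<mapsto> a v(b)\<close>, so its contribution is at most the length of \<open>A\<close>.\<close>
    have small: "finite_length A (ring_module A) {\<zero>\<^bsub>A\<^esub>} (ring.submodule_sum {\<zero>\<^bsub>A\<^esub>} (ring.multiples \<one>\<^bsub>A\<^esub>))"
      by (intro finite_length_mono[OF finite_A]) auto
    have "finite_length A restricted (res.submodule_span (v ` below n b))
      (res.submodule_sum (res.submodule_span (v ` below n b)) (res.multiples (\<one>\<^bsub>A\<^esub> \<odot>\<^bsub>restricted\<^esub> v b)))"
    proof (rule ring.quotient_length_cyclic_map(1)[OF res.module_axioms,
          where f = "\<lambda>a. a \<odot>\<^bsub>restricted\<^esub> v b" and W = "{\<zero>\<^bsub>A\<^esub>}"])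
      show "submodule {\<zero>\<^bsub>A\<^esub>} A (ring_module A)" using ring.submodule_zero by simp
      show "submodule (res.submodule_span (v ` below n b)) A restricted"
        by (rule res.submodule_submodule_span[OF below_car])
      then show "(\<lambda>a. a \<odot>\<^bsub>restricted\<^esub> v b) ` {\<zero>\<^bsub>A\<^esub>} \<subseteq> res.submodule_span (v ` below n b)"
        using res.submodule_zero_mem res.smult_l_null[OF vb] by auto
      show "\<And>x. x \<in> carrier (ring_module A) \<Longrightarrow> x \<odot>\<^bsub>restricted\<^esub> v b \<in> carrier restricted"
        using res.smult_closed[OF _ vb] by simp
      show "\<And>x y. x \<in> carrier (ring_module A) \<Longrightarrow> y \<in> carrier (ring_module A) \<Longrightarrow>
        (x \<oplus>\<^bsub>ring_module A\<^esub> y) \<odot>\<^bsub>restricted\<^esub> v b = x \<odot>\<^bsub>restricted\<^esub> v b \<oplus>\<^bsub>restricted\<^esub> y \<odot>\<^bsub>restricted\<^esub> v b"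
        using res.smult_l_distr[OF _ _ vb] by simp
      show "\<And>a x. a \<in> carrier A \<Longrightarrow> x \<in> carrier (ring_module A) \<Longrightarrow>
        (a \<odot>\<^bsub>ring_module A\<^esub> x) \<odot>\<^bsub>restricted\<^esub> v b = a \<odot>\<^bsub>restricted\<^esub> (x \<odot>\<^bsub>restricted\<^esub> v b)"
        using res.smult_assoc1[OF _ _ vb] by simp
    qed (rule one small)+
    then show ?thesis by (simp only: span_upto[OF b] res.smult_one[OF vb])
  qed
  have anti: "antimono_on (exponents X) (\<lambda>a. len (multidegree \<delta> X a + \<gamma> g) (a, g))" if g: "g \<in> G" for g
  proof (rule monotone_onI)
    fix a a' assume a: "a \<in> exponents X" and a': "a' \<in> exponents X" and le: "a \<le> a'"
    define d where "d = a' - a"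
    have d: "a' = d + a" using eq_diff_index[OF le, of d] by (simp add: d_def)
    have d_exp: "d \<in> exponents X" using a' by (simp add: d_def exponents_def)
    let ?n = "multidegree \<delta> X a + \<gamma> g" and ?n' = "multidegree \<delta> X a' + \<gamma> g"
    let ?f = "\<lambda>m. alg.monomial X d \<odot>\<^bsub>M\<^esub> m"
    let ?W = "res.submodule_span (v ` below ?n (a, g))" and ?W' = "res.submodule_span (v ` below ?n' (a', g))"
    have b: "(a, g) \<in> J ?n" and b': "(a', g) \<in> J ?n'" using a a' g by (auto simp: J_def)
    have vb: "v (a, g) \<in> carrier restricted" using v_car b by blast
    note W = res.submodule_submodule_span[OF below_car]
    have f_v: "?f (v (e, h)) = v (d + e, h)" if "h \<in> G" for e h
      using that Gcar mon by (auto simp: v_def alg.monomial_add[OF Xcar] mod.smult_assoc1)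
    have f_lin: "?f ((c \<odot>\<^bsub>S\<^esub> \<one>\<^bsub>S\<^esub>) \<odot>\<^bsub>M\<^esub> x) = (c \<odot>\<^bsub>S\<^esub> \<one>\<^bsub>S\<^esub>) \<odot>\<^bsub>M\<^esub> ?f x"
      if "c \<in> carrier A" "x \<in> carrier M" for c x
      using that mon[of d] by (simp add: mod.smult_assoc1[symmetric] alg.m_comm)
    let ?T = "{m \<in> carrier M. ?f m \<in> ?W'}"
    \<comment> \<open>Multiplication by \<open>x\<^sup>d\<close> maps the predecessors of \<open>(a, g)\<close> to predecessors of \<open>(a + d, g)\<close>.\<close>
    have "submodule ?T A restricted"
    proof (rule res.submoduleI)
      show "?T \<subseteq> carrier restricted" by auto
      show "\<zero>\<^bsub>restricted\<^esub> \<in> ?T" using res.submodule_zero_mem[OF W] mon by simp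
      show "\<And>y. y \<in> ?T \<Longrightarrow> \<ominus>\<^bsub>restricted\<^esub> y \<in> ?T"
        using res.submoduleE(3)[OF W] mon by (simp add: mod.smult_r_minus)
      show "\<And>y z. y \<in> ?T \<Longrightarrow> z \<in> ?T \<Longrightarrow> y \<oplus>\<^bsub>restricted\<^esub> z \<in> ?T"
        using res.submoduleE(5)[OF W] mon by (simp add: mod.smult_r_distr)
      show "\<And>c y. c \<in> carrier A \<Longrightarrow> y \<in> ?T \<Longrightarrow> c \<odot>\<^bsub>restricted\<^esub> y \<in> ?T"
        using res.submoduleE(4)[OF W] f_lin by simp
    qed
    moreover have "v ` below ?n (a, g) \<subseteq> ?T"
    proof
      fix y assume "y \<in> v ` below ?n (a, g)"
      then obtain e h where eh: "y = v (e, h)" "e \<in> exponents X" "h \<in> G"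
        "multidegree \<delta> X e + \<gamma> h = ?n" "key (e, h) < key (a, g)"
        by (auto simp: below_def J_def)
      have "multidegree \<delta> X (d + e) + \<gamma> h = multidegree \<delta> X d + ?n"
        by (simp only: multidegree_add add.assoc eh(4))
      also have "\<dots> = ?n'" by (simp only: d multidegree_add add.assoc)
      finally have "(d + e, h) \<in> J ?n'" using eh d_exp by (auto simp: J_def exponents_def)
      moreover have "key (d + e, h) < key (a', g)"
        using eh(5) w(2)[of d] by (auto simp: key_def d w(1))
      ultimately have "v (d + e, h) \<in> ?W'"
        using res.submodule_span_superset[of "v ` below ?n' (a', g)"] by (auto simp: below_def)
      moreover have "y \<in> carrier M" using eh Gcar mon by (auto simp: v_def)
      ultimately show "y \<in> ?T" using f_v[OF eh(3)] eh(1) by simp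
    qed
    ultimately have "?W \<subseteq> ?T" by (rule res.submodule_span_minimal[rotated])
    then have image: "?f ` ?W \<subseteq> ?W'" by blast
    have "quotient_length A restricted ?W' (res.submodule_sum ?W' (res.multiples (?f (v (a, g)))))
        \<le> quotient_length A restricted ?W (res.submodule_sum ?W (res.multiples (v (a, g))))"
      by (rule res.quotient_length_cyclic_map(2)[OF res.module_axioms _ _ _ W W image vb])
        (use mon[of d] f_lin fin[OF b] in \<open>auto simp: mod.smult_r_distr span_upto[OF b]\<close>)
    moreover have "?f (v (a, g)) = v (a', g)" using f_v[OF g] d by simp
    ultimately show "len ?n' (a', g) \<le> len ?n (a, g)"
      by (simp only: len_def span_upto[OF b] span_upto[OF b'])
  qed
  let ?l = "\<lambda>g a. len (multidegree \<delta> X a + \<gamma> g) (a, g)"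
  have length: "finite_length A restricted {\<zero>\<^bsub>M\<^esub>} (Mg n)"
    "quotient_length A restricted {\<zero>\<^bsub>M\<^esub>} (Mg n) = (\<Sum>(a, g)\<in>J n. ?l g a)" for n
  proof -
    have "finite_length A restricted (res.submodule_span (v ` {c \<in> J n. key c < key b}))
        (res.submodule_span (v ` {c \<in> J n. key c \<le> key b}))" if "b \<in> J n" for b
      using fin[OF that] by (simp only: below_def upto_def)
    note chain = res.quotient_length_span_chain[of "J n" key v, OF finJ inj v_car this]
    have "finite_length A restricted {\<zero>\<^bsub>M\<^esub>} (Mg n)"
      and len: "quotient_length A restricted {\<zero>\<^bsub>M\<^esub>} (Mg n) = (\<Sum>b\<in>J n. len n b)"
      unfolding len_def below_def upto_def Mg[of n] using chain by simp_all
    then show "finite_length A restricted {\<zero>\<^bsub>M\<^esub>} (Mg n)" by simp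
    have "(\<Sum>b\<in>J n. len n b) = (\<Sum>(a, g)\<in>J n. ?l g a)"
      by (rule sum.cong) (auto simp: J_def)
    with len show "quotient_length A restricted {\<zero>\<^bsub>M\<^esub>} (Mg n) = (\<Sum>(a, g)\<in>J n. ?l g a)" by simp
  qed
  show ?thesis
  proof (rule that)
    show "positive_hilbert_type (\<lambda>n. \<Sum>(a, g)\<in>J n. ?l g a)"
      unfolding J_def by (rule positive_hilbert_type_antitone_sum[OF X(1) G(1) anti])
    show "module_length A (graded_piece S M (Mg n)) = enat (\<Sum>(a, g)\<in>J n. ?l g a)" for n
      using module_length_graded_piece[OF length(1)] by (simp only: length(2))
  qed
qed

end

theorem proposition2p4:
  fixes A :: "('a, 'x) ring_scheme" and \<mm> :: "'a set"
    and S :: "('a, 's, 'y) module_scheme" and Sg :: "('d::finite \<Rightarrow> nat) \<Rightarrow> 's set"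
    and M :: "('s, 'm, 'z) module_scheme" and Mg :: "('d \<Rightarrow> nat) \<Rightarrow> 'm set"
    and k :: "'d \<Rightarrow> nat"
  assumes "artinian_local_ring A \<mm>"
    and "infinite (carrier (A Quot \<mm>))"
    and "standard_multigraded_algebra A S Sg"
    and "fg_multigraded_module S Sg M Mg"
    and "mixed_multiplicity_defined A S M Mg k"
  shows "0 \<le> hilbert_coeff A S M Mg k \<and>
         (\<forall>n. multi_difference k (hilbert_polynomial A S M Mg) n =
              of_int (hilbert_coeff A S M Mg k))"
proof -
  interpret A: artinian_local_ring A \<mm> by (rule assms(1))
  interpret multigraded_module A S Sg M Mg
    using assms(3,4) by (rule multigraded_module.intro)
  have "finite_length A (ring_module A) {\<zero>\<^bsub>A\<^esub>} (carrier A)"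
    by (rule A.artinian_finite_length[OF A.descending_chain_condition])
  note length = positive_hilbert_type_length[OF this]
  obtain f where f: "positive_hilbert_type f"
    "\<And>n. module_length A (graded_piece S M (Mg n)) = enat (f n)"
    by (rule length) (rule that)
  show ?thesis
    by (rule mixed_multiplicity_of_positive_hilbert_type[OF f(2,1) assms(5)])
qed

end
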